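(* Let $A$ be a unital $C^*$-algebra, let $\mathcal{H}$ be a finitely or countably generated Hilbert $A$-module, and let $C\in GL(\mathcal{H})$. Let $m=\{m_j\}_{j\in J}\in\ell^\infty(A)$ with $m_j\in Z(A)$ for each $j\in J$. Assume that $\Phi=\{\phi_j\in\mathcal{H}: j\in J\}$ and $\Psi=\{\psi_j\in\mathcal{H}: j\in J\}$ are $C$-controlled Bessel sequences for $\mathcal{H}$. Then the operator $M_{m,\Phi,\Psi}:\mathcal{H}\to\mathcal{H}$ defined by $$M_{m,\Phi,\Psi}f=\sum_{j\in J}m_j\langle f,\psi_j\rangle C\phi_j$$ is a well-defined bounded operator.
   Context: Hilbert $A$-modules are left modules, with $A$-valued inner product $\langle\cdot,\cdot\rangle$ that is $A$-linear in the first variable, and norm $\|f\|=\|\langle f,f\rangle\|^{1/2}$. $J$ is a finite or countable index set. $Z(A)$ is the center of $A$; $\ell^\infty(A)$ is the set of norm-bounded families in $A$ indexed by $J$. $GL(\mathcal{H})$ is the set of bounded linear operators on $\mathcal{H}$ with a bounded inverse. Given $C\in GL(\mathcal{H})$, a family $\{\psi_j\}_{j\in J}\subseteq\mathcal{H}$ is a $C$-controlled Bessel sequence with bound $M<\infty$ if $$\sum_{j\in J}\langle f,\psi_j\rangle\langle C\psi_j,f\rangle\le M\langle f,f\rangle\quad\text{for all } f\in\mathcal{H},$$ where the sum converges in norm and the inequality is in the order of $A$. For such a sequence the operator $S_Cf=\sum_{j\in J}\langle f,\psi_j\rangle C\psi_j$ (which is well defined on $\mathcal{H}$) is called the $C$-controlled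 frame operator.
   Formalization: Operators in GL(H) are taken A-linear, and C is assumed adjointable or else the series of S_C for Ψ is assumed to converge on H (the context's "well defined"); for general bounded linear C the claim fails. *)

theory Defs
  imports "HOL-Analysis.Analysis"
begin

section \<open>Unital C*-algebras\<close>

text \<open>
  The distribution has no class of complex vector spaces. The one below sits on top of the real
  classes, so that the library's norms, topologies and infinite sums apply to complex spaces.
\<close>

class complex_vector = real_vector +
  fixes scaleC :: "complex \<Rightarrow> 'a \<Rightarrow> 'a" (infixr "*\<^sub>C" 75)
  assumes scaleC_add_right: "c *\<^sub>C (x + y) = c *\<^sub>C x + c *\<^sub>C y"
    and scaleC_add_left: "(c + d) *\<^sub>C x = c *\<^sub>C x + d *\<^sub>C x"
    and scaleC_scaleC: "c *\<^sub>C (d *\<^sub>C x) = (c * d) *\<^sub>C x"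
    and scaleC_of_real: "complex_of_real r *\<^sub>C x = r *\<^sub>R x"

class unital_cstar_algebra = complex_vector + real_normed_algebra_1 + banach +
  fixes star :: "'a \<Rightarrow> 'a"
  assumes scaleC_mult_left: "(c *\<^sub>C x) * y = c *\<^sub>C (x * y)"
    and scaleC_mult_right: "x * (c *\<^sub>C y) = c *\<^sub>C (x * y)"
    and norm_scaleC: "norm (c *\<^sub>C x) = cmod c * norm x"
    and star_star: "star (star x) = x"
    and star_add: "star (x + y) = star x + star y"
    and star_scaleC: "star (c *\<^sub>C x) = cnj c *\<^sub>C star x"
    and star_mult: "star (x * y) = star y * star x"
    and cstar_identity: "norm (star x * x) = (norm x)\<^sup>2"

definition positive :: "'a::unital_cstar_algebra \<Rightarrow> bool" where
  "positive a \<longleftrightarrow> (\<exists>x. a = star x * x)"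

definition cstar_le :: "'a::unital_cstar_algebra \<Rightarrow> 'a \<Rightarrow> bool" (infix "\<le>\<^sub>A" 50) where
  "a \<le>\<^sub>A b \<longleftrightarrow> positive (b - a)"

definition center :: "'a::unital_cstar_algebra set" where
  "center = {z. \<forall>a. z * a = a * z}"

section \<open>Hilbert modules\<close>

text \<open>
  The action of \<open>A\<close> and the inner product are parameters, since a type class
  cannot relate the type of the module to the type of the algebra. Completeness
  is part of the sort \<open>banach\<close>, whose norm is tied to the inner product by
  \<open>norm_eq\<close>.
\<close>

locale hilbert_module =
  fixes act :: "'a::unital_cstar_algebra \<Rightarrow> 'h::{complex_vector,banach} \<Rightarrow> 'h"
    and ip :: "'h \<Rightarrow> 'h \<Rightarrow> 'a"
  assumes act_add_right: "act a (f + g) = act a f + act a g"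
    and act_add_left: "act (a + b) f = act a f + act b f"
    and act_act: "act a (act b f) = act (a * b) f"
    and act_one: "act 1 f = f"
    and act_scaleC_left: "act (c *\<^sub>C a) f = c *\<^sub>C act a f"
    and act_scaleC_right: "act a (c *\<^sub>C f) = c *\<^sub>C act a f"
    and ip_add_left: "ip (f + g) h = ip f h + ip g h"
    and ip_act_left: "ip (act a f) g = a * ip f g"
    and ip_star: "star (ip f g) = ip g f"
    and ip_positive: "positive (ip f f)"
    and ip_definite: "ip f f = 0 \<Longrightarrow> f = 0"
    and norm_eq: "norm f = sqrt (norm (ip f f))"

definition module_span :: "('a::unital_cstar_algebra \<Rightarrow> 'h \<Rightarrow> 'h) \<Rightarrow> 'h set \<Rightarrow> 'h::{complex_vector,banach} set" where
  "module_span act G = {\<Sum>g\<in>F. act (c g) g | F c. finite F \<and> F \<subseteq> G}"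

definition finitely_generated :: "('a::unital_cstar_algebra \<Rightarrow> 'h::{complex_vector,banach} \<Rightarrow> 'h) \<Rightarrow> bool" where
  "finitely_generated act \<longleftrightarrow> (\<exists>G. finite G \<and> module_span act G = UNIV)"

definition countably_generated :: "('a::unital_cstar_algebra \<Rightarrow> 'h::{complex_vector,banach} \<Rightarrow> 'h) \<Rightarrow> bool" where
  "countably_generated act \<longleftrightarrow> (\<exists>G. countable G \<and> closure (module_span act G) = UNIV)"

text \<open>Linear operators on a module are \<open>A\<close>-linear; the action of \<open>c *\<^sub>C 1\<close> makes them complex linear.\<close>

definition bounded_module_operator ::
    "('a::unital_cstar_algebra \<Rightarrow> 'h::{complex_vector,banach} \<Rightarrow> 'h) \<Rightarrow> ('h \<Rightarrow> 'h) \<Rightarrow> bool" where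
  "bounded_module_operator act T \<longleftrightarrow> bounded_linear T \<and> (\<forall>a f. T (act a f) = act a (T f))"

definition GL :: "('a::unital_cstar_algebra \<Rightarrow> 'h::{complex_vector,banach} \<Rightarrow> 'h) \<Rightarrow> ('h \<Rightarrow> 'h) set" where
  "GL act = {C. bounded_module_operator act C \<and>
     (\<exists>D. bounded_module_operator act D \<and> D \<circ> C = id \<and> C \<circ> D = id)}"

definition adjointable :: "('h \<Rightarrow> 'h \<Rightarrow> 'a) \<Rightarrow> ('h \<Rightarrow> 'h) \<Rightarrow> bool" where
  "adjointable ip T \<longleftrightarrow> (\<exists>T'. \<forall>f g. ip (T f) g = ip f (T' g))"

section \<open>Controlled Bessel sequences and multipliers\<close>

text \<open>
  The index set carries no order, so sums over it are the library's unordered sums, with respect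
  to the norm topology. No adjointability or positivity of \<open>C\<close> is required here; note that
  \<open>\<le>\<^sub>A\<close> forces the sum to be self-adjoint, but not to be positive.
\<close>

definition controlled_bessel ::
    "('h \<Rightarrow> 'h \<Rightarrow> 'a::unital_cstar_algebra) \<Rightarrow> ('h \<Rightarrow> 'h) \<Rightarrow> 'j set \<Rightarrow> ('j \<Rightarrow> 'h) \<Rightarrow> bool" where
  "controlled_bessel ip C J \<psi> \<longleftrightarrow> (\<exists>M::real. \<forall>f.
     (\<lambda>j. ip f (\<psi> j) * ip (C (\<psi> j)) f) summable_on J \<and>
     (\<Sum>\<^sub>\<infinity>j\<in>J. ip f (\<psi> j) * ip (C (\<psi> j)) f) \<le>\<^sub>A M *\<^sub>R ip f f)"

text \<open>
  Convergence of the series of the controlled frame operator. It follows from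
  \<open>controlled_bessel\<close> if \<open>C\<close> is adjointable, but not for every element of
  \<open>GL\<close>: let \<open>A\<close> be the algebra of convergent sequences, \<open>H\<close> its direct sum with the ideal of
  null sequences, \<open>C (a, b) = (a + b, - b)\<close>, and \<open>d n\<close> the sequence that is 1 at \<open>n\<close> and 0
  elsewhere. The vectors \<open>(d n, - d n)\<close> and \<open>(0, d n)\<close>, for all \<open>n\<close>, form a \<open>C\<close>-controlled
  Bessel sequence, but at \<open>f = (1, 0)\<close> the nonzero terms of the series are the \<open>(0, d n)\<close>.
\<close>

definition controlled_frame_operator_converges ::
    "('a::unital_cstar_algebra \<Rightarrow> 'h::{complex_vector,banach} \<Rightarrow> 'h) \<Rightarrow> ('h \<Rightarrow> 'h \<Rightarrow> 'a) \<Rightarrow>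
      ('h \<Rightarrow> 'h) \<Rightarrow> 'j set \<Rightarrow> ('j \<Rightarrow> 'h) \<Rightarrow> bool" where
  "controlled_frame_operator_converges act ip C J \<psi> \<longleftrightarrow>
     (\<forall>f. (\<lambda>j. act (ip f (\<psi> j)) (C (\<psi> j))) summable_on J)"

definition multiplier_term ::
    "('a::unital_cstar_algebra \<Rightarrow> 'h::{complex_vector,banach} \<Rightarrow> 'h) \<Rightarrow> ('h \<Rightarrow> 'h \<Rightarrow> 'a) \<Rightarrow>
      ('h \<Rightarrow> 'h) \<Rightarrow> ('j \<Rightarrow> 'a) \<Rightarrow> ('j \<Rightarrow> 'h) \<Rightarrow> ('j \<Rightarrow> 'h) \<Rightarrow> 'h \<Rightarrow> 'j \<Rightarrow> 'h" where
  "multiplier_term act ip C m \<phi> \<psi> f j = act (m j * ip f (\<psi> j)) (C (\<phi> j))"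

definition multiplier ::
    "('a::unital_cstar_algebra \<Rightarrow> 'h::{complex_vector,banach} \<Rightarrow> 'h) \<Rightarrow> ('h \<Rightarrow> 'h \<Rightarrow> 'a) \<Rightarrow>
      ('h \<Rightarrow> 'h) \<Rightarrow> 'j set \<Rightarrow> ('j \<Rightarrow> 'a) \<Rightarrow> ('j \<Rightarrow> 'h) \<Rightarrow> ('j \<Rightarrow> 'h) \<Rightarrow> 'h \<Rightarrow> 'h" where
  "multiplier act ip C J m \<phi> \<psi> f = (\<Sum>\<^sub>\<infinity>j\<in>J. multiplier_term act ip C m \<phi> \<psi> f j)"

end

theory Submission
  imports Defs
begin

text \<open>
  Polarization makes \<open>\<Sum>\<^sub>j \<langle>f,\<phi>\<^sub>j\<rangle>\<langle>C \<phi>\<^sub>j,g\<rangle>\<close> converge for all \<open>f, g\<close>, so by uniform boundedness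
  the operators \<open>f \<mapsto> \<Sum>\<^sub>j\<^sub>\<in>\<^sub>F \<langle>f,\<phi>\<^sub>j\<rangle> C \<phi>\<^sub>j\<close> with finite \<open>F\<close> are bounded by a common constant. Applying
  \<open>C\<^sup>-\<^sup>1\<close> shows that the sums \<open>\<Sum>\<^sub>j\<^sub>\<in>\<^sub>F \<langle>f,\<phi>\<^sub>j\<rangle>\<langle>\<phi>\<^sub>j,f\<rangle>\<close> are bounded by a multiple of
  \<open>\<parallel>f\<parallel>\<^sup>2\<close>, for \<open>\<phi> = \<Phi>\<close> and \<open>\<phi> = \<Psi>\<close>. For \<open>\<Psi>\<close> they also converge: apply \<open>C\<^sup>-\<^sup>1\<close> to the series
  of the controlled frame operator or, if \<open>C\<close> is adjointable, put \<open>f = C\<^sup>* g\<close>, as \<open>C\<^sup>*\<close> is surjective.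
  By the Cauchy-Schwarz inequality in the powers of \<open>A\<close>, a finite partial sum of the multiplier
  series has squared norm at most a constant times \<open>\<parallel>\<Sum>\<^sub>j\<^sub>\<in>\<^sub>F \<langle>f,\<psi>\<^sub>j\<rangle>\<langle>\<psi>\<^sub>j,f\<rangle>\<parallel>\<close>, so the series is
  Cauchy. That inequality rests on the Kelley-Vaught theorem that sums of elements \<open>x\<^sup>* x\<close> are
  again of this form.
\<close>

section \<open>Involution and square roots\<close>

lemma scaleC_zero_left: "0 *\<^sub>C x = (0::'a::complex_vector)"
  using scaleC_of_real[of 0 x] by simp

lemma scaleC_minus_left: "(- c) *\<^sub>C x = - (c *\<^sub>C (x::'a::complex_vector))"
  using scaleC_add_left[of "- c" c x] by (simp add: scaleC_zero_left eq_neg_iff_add_eq_0)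

lemma norm_star [simp]: "norm (star x) = norm (x::'a::unital_cstar_algebra)"
proof (rule antisym)
  have le: "norm y \<le> norm (star y)" for y :: 'a
  proof (cases "y = 0")
    case False
    have "(norm y)\<^sup>2 \<le> norm (star y) * norm y"
      using norm_mult_ineq[of "star y" y] by (simp add: cstar_identity)
    then show ?thesis using False by (simp add: power2_eq_square)
  qed simp
  show "norm x \<le> norm (star x)" by (rule le)
  show "norm (star x) \<le> norm x" using le[of "star x"] by (simp add: star_star)
qed

lemma bounded_linear_star: "bounded_linear (star :: 'a::unital_cstar_algebra \<Rightarrow> 'a)"
proof (rule bounded_linear_intro[where K = 1])
  show "star (r *\<^sub>R x) = r *\<^sub>R star x" for r and x :: 'a
    by (simp add: star_scaleC flip: scaleC_of_real)
qed (auto simp: star_add)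

lemmas star_scaleR = linear_cmul[OF bounded_linear.linear[OF bounded_linear_star]]
  and star_zero [simp] = linear_0[OF bounded_linear.linear[OF bounded_linear_star]]
  and star_diff = linear_diff[OF bounded_linear.linear[OF bounded_linear_star]]
  and star_sum = linear_sum[OF bounded_linear.linear[OF bounded_linear_star]]
  and star_suminf = bounded_linear.suminf[OF bounded_linear_star]

lemma star_one [simp]: "star 1 = (1::'a::unital_cstar_algebra)"
  using star_mult[of "star 1" "1::'a"] by (simp add: star_star)

lemma star_power: "star (x ^ n) = star (x::'a::unital_cstar_algebra) ^ n"
  by (induction n) (simp_all add: star_mult power_commutes)

lemma norm_mult_star: "norm (x * star x) = (norm (x::'a::unital_cstar_algebra))\<^sup>2"
  using cstar_identity[of "star x"] by (simp add: star_star)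

lemma norm_square: "star x = x \<Longrightarrow> norm (x * x) = (norm (x::'a::unital_cstar_algebra))\<^sup>2"
  using cstar_identity[of x] by simp

lemma square_eq_0: "star x = x \<Longrightarrow> x * x = 0 \<Longrightarrow> (x::'a::unital_cstar_algebra) = 0"
  using norm_square[of x] by simp

lemma scaleC_i_i: "\<i> *\<^sub>C \<i> *\<^sub>C x = - (x::'a::complex_vector)"
  using scaleC_of_real[of "-1" x] by (simp add: scaleC_scaleC)

lemma scaleC_minus_right: "c *\<^sub>C (- x) = - (c *\<^sub>C (x::'a::complex_vector))"
  using scaleC_scaleC[of c "- 1" x] scaleC_scaleC[of "- 1" c x] scaleC_of_real[of "-1" x]
    scaleC_of_real[of "-1" "c *\<^sub>C x"] by simp

lemma scaleC_diff_right: "c *\<^sub>C (x - y) = c *\<^sub>C x - c *\<^sub>C (y::'a::complex_vector)"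
  using scaleC_add_right[of c x "- y"] by (simp add: scaleC_minus_right)

lemmas scaleC_simps = scaleC_add_right scaleC_diff_right scaleC_minus_right scaleC_minus_left
  scaleC_i_i scaleC_mult_left scaleC_mult_right

section \<open>Square roots by the binomial series of sqrt(1 - z)\<close>

definition sqrt_coeff :: "nat \<Rightarrow> real" where
  "sqrt_coeff n = (1/2 gchoose n) * (- 1) ^ n"

lemma sqrt_coeff_0: "sqrt_coeff 0 = 1"
  by (simp add: sqrt_coeff_def)

text \<open>Written as a rising factorial, the coefficient has exactly one negative factor, the
  first one, -1/2. The constant sign turns sums of absolute values into signed sums, which have a
  closed form.\<close>

lemma sqrt_coeff_Suc: "sqrt_coeff (Suc n) \<le> 0"
proof -
  have "sqrt_coeff (Suc n) = pochhammer (- 1/2) (Suc n) / fact (Suc n)"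
    by (simp add: sqrt_coeff_def gbinomial_pochhammer flip: power_mult_distrib)
  also have "\<dots> = - (1/2 * pochhammer (1/2) n / fact (Suc n))"
    by (simp add: pochhammer_rec)
  also have "\<dots> \<le> 0"
    using pochhammer_pos[of "1/2::real" n] by simp
  finally show ?thesis .
qed

text \<open>The signed partial sums are quotients of rising factorials of 1/2 by factorials, hence
  nonnegative, and only the leading coefficient 1 is positive. So the series converges absolutely on
  the whole closed unit ball.\<close>

lemma sum_abs_sqrt_coeff: "(\<Sum>n<m. \<bar>sqrt_coeff (Suc n)\<bar>) \<le> 1"
proof -
  have "(\<Sum>n\<le>m. sqrt_coeff n) = (- 1) ^ m * (- 1/2 gchoose m)"
    using gbinomial_sum_lower_neg[of "1/2::real" m] by (simp add: sqrt_coeff_def)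
  also have "\<dots> = pochhammer (1/2) m / fact m"
    by (simp add: gbinomial_pochhammer flip: power_mult_distrib)
  also have "\<dots> \<ge> 0"
    using pochhammer_pos[of "1/2::real" m] by simp
  finally have "0 \<le> 1 + (\<Sum>n<m. sqrt_coeff (Suc n))"
    by (simp add: sum.atMost_shift sqrt_coeff_0)
  then show ?thesis
    using sqrt_coeff_Suc by (simp add: abs_of_nonpos sum_negf)
qed

lemma summable_abs_sqrt_coeff: "summable (\<lambda>n. \<bar>sqrt_coeff n\<bar>)"
proof -
  have "summable (\<lambda>n. \<bar>sqrt_coeff (Suc n)\<bar>)"
    by (rule summableI_nonneg_bounded[OF _ sum_abs_sqrt_coeff]) simp
  then show ?thesis by (subst (asm) summable_Suc_iff)
qed

text \<open>Vandermonde's identity for 1/2 + 1/2 = 1: the Cauchy square of the series is 1 -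
  z.\<close>

lemma sqrt_coeff_convolution:
  "(\<Sum>i\<le>n. sqrt_coeff i * sqrt_coeff (n - i)) = (if n = 0 then 1 else if n = 1 then - 1 else 0)"
proof -
  have "(\<Sum>i\<le>n. sqrt_coeff i * sqrt_coeff (n - i))
      = (\<Sum>i\<le>n. ((1/2 gchoose i) * (1/2 gchoose (n - i))) * (- 1) ^ n)"
    by (rule sum.cong) (auto simp: sqrt_coeff_def simp flip: power_add)
  also have "\<dots> = (1 gchoose n) * (- 1) ^ n"
    using gbinomial_Vandermonde[of "1/2::real" "1/2" n]
    by (simp add: atLeast0AtMost flip: sum_distrib_right)
  also have "\<dots> = real (1 choose n) * (- 1) ^ n"
    by (simp add: binomial_gbinomial)
  also have "\<dots> = (if n = 0 then 1 else if n = 1 then - 1 else 0)"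
    by (auto simp: binomial_eq_0)
  finally show ?thesis .
qed

text \<open>The root is the value of the series at \<open>z\<close>; self-adjointness and
  commutation pass from the powers of \<open>z\<close> to the limit. The bound on
  \<open>1 - k\<close> later puts the root back into \<open>positive_cone\<close>.\<close>

lemma sqrt_one_minus:
  fixes z :: "'a::unital_cstar_algebra"
  assumes "norm z \<le> 1"
  obtains k where "k * k = 1 - z" and "norm (1 - k) \<le> 1" and "star z = z \<Longrightarrow> star k = k"
    and "\<And>w. w * z = z * w \<Longrightarrow> w * k = k * w"
proof -
  define t where "t n = sqrt_coeff n *\<^sub>R z ^ n" for n
  define k where "k = (\<Sum>n. t n)"
  have norm_t: "norm (t n) \<le> \<bar>sqrt_coeff n\<bar>" for n
  proof -
    have "norm (z ^ n) \<le> norm z ^ n" by (rule norm_power_ineq)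
    also have "\<dots> \<le> 1" using assms by (simp add: power_le_one)
    finally show ?thesis by (simp add: t_def mult_left_le)
  qed
  have norm_summable: "summable (\<lambda>n. norm (t n))"
    by (rule summable_comparison_test'[OF summable_abs_sqrt_coeff, of 0]) (simp add: norm_t)
  then have summable: "summable t" by (rule summable_norm_cancel)
  show ?thesis
  proof
    have "(\<lambda>n. \<Sum>i\<le>n. t i * t (n - i)) sums (k * k)"
      unfolding k_def by (rule Cauchy_product_sums[OF norm_summable norm_summable])
    also have "(\<lambda>n. \<Sum>i\<le>n. t i * t (n - i))
        = (\<lambda>n. (if n = 0 then 1 else if n = 1 then - 1 else 0) *\<^sub>R z ^ n)"
    proof
      fix n
      have "(\<Sum>i\<le>n. t i * t (n - i)) = (\<Sum>i\<le>n. sqrt_coeff i * sqrt_coeff (n - i)) *\<^sub>R z ^ n"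
        unfolding scaleR_sum_left by (rule sum.cong) (auto simp: t_def simp flip: power_add)
      then show "(\<Sum>i\<le>n. t i * t (n - i))
          = (if n = 0 then 1 else if n = 1 then - 1 else 0) *\<^sub>R z ^ n"
        by (simp only: sqrt_coeff_convolution)
    qed
    finally have "(\<lambda>n. (if n = 0 then 1 else if n = 1 then - 1 else 0) *\<^sub>R z ^ n) sums (k * k)" .
    moreover have "(\<lambda>n. (if n = 0 then 1 else if n = 1 then - 1 else 0) *\<^sub>R z ^ n) sums
        (\<Sum>n\<in>{0, 1}. (if n = 0 then 1 else if n = 1 then - 1 else 0) *\<^sub>R z ^ n)"
      by (rule sums_finite) auto
    ultimately show "k * k = 1 - z"
      by (auto dest: sums_unique2)
    have "k = t 0 + (\<Sum>n. t (Suc n))"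
      unfolding k_def using suminf_split_head[OF summable] by simp
    then have "norm (1 - k) = norm (\<Sum>n. t (Suc n))"
      by (simp add: t_def sqrt_coeff_0)
    also have "\<dots> \<le> (\<Sum>n. norm (t (Suc n)))"
      using norm_summable by (intro summable_norm) (subst summable_Suc_iff)
    also have "\<dots> \<le> (\<Sum>n. \<bar>sqrt_coeff (Suc n)\<bar>)"
      using norm_summable summable_abs_sqrt_coeff
      by (intro suminf_le norm_t) (subst summable_Suc_iff, assumption)+
    also have "\<dots> \<le> 1"
      using summable_abs_sqrt_coeff
      by (intro suminf_le_const sum_abs_sqrt_coeff) (subst summable_Suc_iff)
    finally show "norm (1 - k) \<le> 1" .
    show "star k = k" if "star z = z"
    proof -
      have "star (t n) = t n" for n by (simp add: t_def star_scaleR star_power that)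
      then show ?thesis unfolding k_def star_suminf[OF summable] by simp
    qed
    show "w * k = k * w" if "w * z = z * w" for w
    proof -
      have "w * t n = t n * w" for n
        using power_commuting_commutes[of z w n] that by (simp add: t_def)
      then show ?thesis
        unfolding k_def using suminf_mult[OF summable, of w] suminf_mult2[OF summable, of w] by simp
    qed
  qed
qed

section \<open>Positive elements\<close>

text \<open>Closed under addition by the triangle inequality; \<open>positive_iff\<close> below identifies it with
  the set of all \<open>star x * x\<close>.\<close>

definition positive_cone :: "'a::unital_cstar_algebra set" where
  "positive_cone = {a. star a = a \<and> (\<exists>t. norm (t *\<^sub>R 1 - a) \<le> t)}"

lemma positive_cone_add:
  assumes "a \<in> positive_cone" "b \<in> positive_cone"
  shows "a + b \<in> positive_cone"
proof -
  from assms obtain s t where "norm (s *\<^sub>R 1 - a) \<le> s" "norm (t *\<^sub>R 1 - b) \<le> t"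
    by (auto simp: positive_cone_def)
  then have "norm ((s + t) *\<^sub>R 1 - (a + b)) \<le> s + t"
    using norm_triangle_ineq[of "s *\<^sub>R 1 - a" "t *\<^sub>R 1 - b"] by (simp add: algebra_simps)
  with assms show ?thesis by (auto simp: positive_cone_def star_add)
qed

lemma positive_cone_scaleR:
  assumes "a \<in> positive_cone" "0 \<le> r"
  shows "r *\<^sub>R a \<in> positive_cone"
proof -
  from assms obtain t where "norm (t *\<^sub>R 1 - a) \<le> t"
    by (auto simp: positive_cone_def)
  then have "norm (r *\<^sub>R (t *\<^sub>R 1 - a)) \<le> r * t"
    using assms(2) by (simp add: mult_left_mono)
  then have "norm ((r * t) *\<^sub>R 1 - r *\<^sub>R a) \<le> r * t"
    by (simp add: scaleR_diff_right)
  with assms show ?thesis by (auto simp: positive_cone_def star_scaleR)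
qed

lemma positive_cone_diff:
  assumes "star a = a" "norm a \<le> s"
  shows "s *\<^sub>R 1 - a \<in> positive_cone"
  using assms by (auto simp: positive_cone_def star_diff star_scaleR intro!: exI[of _ s])

lemma positive_cone_sqrt:
  assumes "a \<in> positive_cone"
  obtains k where "k * k = a" and "k \<in> positive_cone" and "star k = k"
    and "\<And>w. w * a = a * w \<Longrightarrow> w * k = k * w"
proof -
  from assms obtain t where t: "norm (t *\<^sub>R 1 - a) \<le> t" and a: "star a = a"
    by (auto simp: positive_cone_def)
  have "0 \<le> t" using t norm_ge_zero order_trans by blast
  show ?thesis
  proof (cases "t = 0")
    case True
    with t have "a = 0" by simp
    with assms show ?thesis by (intro that[of 0]) auto
  next
    case False
    with \<open>0 \<le> t\<close> have "0 < t" by simp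
    \<comment> \<open>\<open>a\<close> is \<open>t\<close> times \<open>1 - z\<close> with
      \<open>z\<close> in the closed unit ball, so its root is \<open>sqrt t\<close> times that of
      \<open>1 - z\<close>.\<close>
    define z where "z = 1 - (1 / t) *\<^sub>R a"
    have "z = (1 / t) *\<^sub>R (t *\<^sub>R 1 - a)"
      using \<open>0 < t\<close> by (simp add: z_def scaleR_diff_right)
    then have "norm z = norm (t *\<^sub>R 1 - a) / t" using \<open>0 < t\<close> by simp
    then have "norm z \<le> 1" using t \<open>0 < t\<close> by simp
    then obtain k where k: "k * k = 1 - z" "norm (1 - k) \<le> 1" "star z = z \<Longrightarrow> star k = k"
      "\<And>w. w * z = z * w \<Longrightarrow> w * k = k * w"
      by (rule sqrt_one_minus) blast
    have "star k = k"
      by (rule k(3)) (simp add: z_def a star_diff star_scaleR)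
    show ?thesis
    proof (rule that)
      show "(sqrt t *\<^sub>R k) * (sqrt t *\<^sub>R k) = a"
        using \<open>0 < t\<close> by (simp add: k(1) z_def)
      show "star (sqrt t *\<^sub>R k) = sqrt t *\<^sub>R k"
        by (simp add: star_scaleR \<open>star k = k\<close>)
      have "k \<in> positive_cone"
        using k(2) \<open>star k = k\<close> by (auto simp: positive_cone_def intro!: exI[of _ 1])
      then show "sqrt t *\<^sub>R k \<in> positive_cone"
        using \<open>0 < t\<close> by (simp add: positive_cone_scaleR)
      show "w * (sqrt t *\<^sub>R k) = (sqrt t *\<^sub>R k) * w" if "w * a = a * w" for w
        using k(4)[of w] that by (simp add: z_def algebra_simps)
    qed
  qed
qed

text \<open>For \<open>w = u + i v\<close> commutation gives \<open>star w * w = s\<close>, and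
  \<open>u\<close> is the real part of \<open>w\<close>, so \<open>norm u \<le> norm w\<close>. This
  stands in for a spectral argument in the commutative algebra generated by \<open>u\<close> and
  \<open>v\<close>.\<close>

lemma norm_le_of_squares_sum:
  fixes u v :: "'a::unital_cstar_algebra"
  assumes "star u = u" "star v = v" "u * v = v * u" "u * u + v * v = s *\<^sub>R 1" "0 \<le> s"
  shows "(norm u)\<^sup>2 \<le> s"
proof -
  define w where "w = u + \<i> *\<^sub>C v"
  have star_w: "star w = u - \<i> *\<^sub>C v"
    by (simp add: w_def assms star_add star_scaleC scaleC_minus_left)
  have "star w * w = u * u + v * v"
    unfolding star_w unfolding w_def
    by (simp add: algebra_simps scaleC_simps assms(3))
  then have "norm (star w * w) = s" using assms by simp
  then have "(norm w)\<^sup>2 = s" by (simp add: cstar_identity)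
  moreover have "norm u \<le> norm w"
  proof -
    have "2 *\<^sub>R u = w + star w" unfolding star_w by (simp add: w_def scaleR_2)
    then have "norm (2 *\<^sub>R u) \<le> norm w + norm (star w)"
      by (metis norm_triangle_ineq)
    then show ?thesis by simp
  qed
  ultimately show ?thesis using power_mono[of "norm u" "norm w" 2] by simp
qed

text \<open>After scaling to norm 1, let \<open>k\<close> be the root of \<open>1 - g * g\<close>.
  It commutes with \<open>g\<close> and \<open>k * k + g * g = 1\<close>, which forces
  \<open>norm k \<le> 1\<close>; hence \<open>g * g\<close> lies within distance 1 of the
  unit.\<close>

lemma square_in_positive_cone:
  fixes h :: "'a::unital_cstar_algebra"
  assumes "star h = h"
  shows "h * h \<in> positive_cone"
proof (cases "h = 0")
  case True
  then show ?thesis by (auto simp: positive_cone_def intro!: exI[of _ 0])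
next
  case False
  define g where "g = (1 / norm h) *\<^sub>R h"
  have g: "star g = g" "norm g = 1"
    using False by (simp_all add: g_def star_scaleR assms)
  then have "norm (g * g) \<le> 1" by (simp add: norm_square)
  then obtain k where k: "k * k = 1 - g * g" "star (g * g) = g * g \<Longrightarrow> star k = k"
      "\<And>w. w * (g * g) = (g * g) * w \<Longrightarrow> w * k = k * w"
    by (rule sqrt_one_minus) blast
  have "star k = k" by (rule k(2)) (simp add: g star_mult)
  have "k * g = g * k" using k(3)[of g] by (simp add: mult.assoc)
  then have "(norm k)\<^sup>2 \<le> 1"
    by (intro norm_le_of_squares_sum[of k g]) (simp_all add: \<open>star k = k\<close> g k(1))
  then have "norm (1 - g * g) \<le> 1"
    by (simp add: norm_square \<open>star k = k\<close> flip: k(1))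
  then have "g * g \<in> positive_cone"
    by (auto simp: positive_cone_def star_mult g intro!: exI[of _ 1])
  then have "(norm h)\<^sup>2 *\<^sub>R (g * g) \<in> positive_cone"
    by (rule positive_cone_scaleR) simp
  moreover have "(norm h)\<^sup>2 *\<^sub>R (g * g) = h * h"
    using False by (simp add: g_def power2_eq_square)
  ultimately show ?thesis by simp
qed

text \<open>With \<open>s = norm (a + b)\<close>, the element \<open>s - a\<close> is the sum of
  \<open>s - (a + b)\<close> and \<open>b\<close>, hence in the cone. Its root commutes with that of
  \<open>a\<close>, and their squares add up to \<open>s\<close>.\<close>

lemma positive_cone_norm_mono:
  fixes a b :: "'a::unital_cstar_algebra"
  assumes "a \<in> positive_cone" "b \<in> positive_cone"
  shows "norm a \<le> norm (a + b)"
proof -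
  define s where "s = norm (a + b)"
  have "star (a + b) = a + b" using assms by (simp add: positive_cone_def star_add)
  then have "(s *\<^sub>R 1 - (a + b)) + b \<in> positive_cone"
    by (intro positive_cone_add positive_cone_diff assms) (simp_all add: s_def)
  then have "s *\<^sub>R 1 - a \<in> positive_cone" by (simp add: algebra_simps)
  then obtain v where v: "v * v = s *\<^sub>R 1 - a" "star v = v"
    "\<And>w. w * (s *\<^sub>R 1 - a) = (s *\<^sub>R 1 - a) * w \<Longrightarrow> w * v = v * w"
    by (rule positive_cone_sqrt) blast
  obtain u where u: "u * u = a" "star u = u"
    by (rule positive_cone_sqrt[OF assms(1)]) blast
  have "u * v = v * u"
    by (rule v(3)) (simp add: algebra_simps flip: u(1))
  then have "(norm u)\<^sup>2 \<le> s"
    by (intro norm_le_of_squares_sum[of u v]) (simp_all add: u v s_def)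
  then show ?thesis using norm_square[OF u(2)] by (simp add: u(1) s_def)
qed

text \<open>Twice this element is the sum of two self-adjoint squares, those of twice the real and
  twice the imaginary part of \<open>y\<close>, up to sign.\<close>

lemma star_mult_plus_mult_star_in_positive_cone:
  "star y * y + y * star y \<in> positive_cone"
proof -
  define h where "h = y + star y"
  define k where "k = \<i> *\<^sub>C (y - star y)"
  have "star h = h" by (simp add: h_def star_add star_star)
  moreover have "star k = k"
    by (simp add: k_def star_scaleC star_diff star_star scaleC_simps)
  ultimately have "(1/2) *\<^sub>R (h * h + k * k) \<in> positive_cone"
    by (intro positive_cone_scaleR positive_cone_add square_in_positive_cone) simp_all
  also have "h * h + k * k = 2 *\<^sub>R (star y * y + y * star y)"
    by (simp add: h_def k_def scaleC_simps algebra_simps scaleR_2)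
  finally show ?thesis by simp
qed

text \<open>The Kelley-Vaught theorem without spectra: with \<open>y * star y = p\<^sup>2\<close>, both
  \<open>star z * z\<close> and \<open>z * star z\<close> are negative for \<open>z = q * star y\<close>, while their sum is in the
  cone.\<close>

lemma eq_0_of_star_mult_self_negative:
  fixes y :: "'a::unital_cstar_algebra"
  assumes "star y * y = - (q * q)" "star q = q"
  shows "y = 0"
proof -
  \<comment> \<open>This sum equals \<open>y * star y\<close>, which therefore has a self-adjoint
    root \<open>p\<close>.\<close>
  have "(star y * y + y * star y) + q * q \<in> positive_cone"
    by (intro positive_cone_add star_mult_plus_mult_star_in_positive_cone
        square_in_positive_cone assms)
  then have "y * star y \<in> positive_cone" by (simp add: assms(1))
  then obtain p where p: "p * p = y * star y" "star p = p"
    by (rule positive_cone_sqrt) blast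
  define z where "z = q * star y"
  have "star z * z = y * (q * q) * star y"
    by (simp add: z_def star_mult star_star assms(2) mult.assoc)
  also have "\<dots> = - (y * (star y * y) * star y)"
    by (simp add: assms(1))
  also have "\<dots> = - ((p * p) * (p * p))"
    by (simp only: p mult.assoc)
  finally have z1: "star z * z = - ((p * p) * (p * p))" .
  have "z * star z = q * (star y * y) * q"
    by (simp add: z_def star_mult star_star assms(2) mult.assoc)
  then have z2: "z * star z = - ((q * q) * (q * q))"
    by (simp add: assms(1) mult.assoc)
  have pp: "star (p * p) = p * p" and qq: "star (q * q) = q * q"
    by (simp_all add: star_mult p(2) assms)
  \<comment> \<open>By \<open>z1\<close> and \<open>z2\<close> the element inside the right-hand
    norm is 0.\<close>
  have "norm ((p * p) * (p * p)) \<le>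
      norm ((p * p) * (p * p) + ((star z * z + z * star z) + (q * q) * (q * q)))"
    by (intro positive_cone_norm_mono positive_cone_add star_mult_plus_mult_star_in_positive_cone
        square_in_positive_cone pp qq)
  then have "(p * p) * (p * p) = 0" by (simp add: z1 z2)
  then have "p * p = 0" using square_eq_0[OF pp] by simp
  then have "norm (y * star y) = 0" using p by simp
  then show ?thesis by (simp add: norm_mult_star)
qed

text \<open>For \<open>a = star x * x\<close> let \<open>b\<close> be the root of
  \<open>a * a\<close>, the absolute value of \<open>a\<close>; then \<open>n = b - a\<close> is
  twice the negative part. As \<open>a * n = - (b * n)\<close>, the element
  \<open>star (x * n) * (x * n)\<close> is \<open>- (b * (n * n))\<close>, so
  \<open>x * n = 0\<close> by the preceding lemma, and this makes \<open>n\<close> vanish.\<close>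

theorem positive_iff: "positive a \<longleftrightarrow> a \<in> positive_cone"
proof
  assume "a \<in> positive_cone"
  then obtain k where "k * k = a" "star k = k" by (rule positive_cone_sqrt) blast
  then have "a = star k * k" by simp
  then show "positive a" unfolding positive_def ..
next
  assume "positive a"
  then obtain x where x: "a = star x * x" by (auto simp: positive_def)
  have a: "star a = a" by (simp add: x star_mult star_star)
  obtain b where b: "b * b = a * a" "b \<in> positive_cone" "star b = b"
    "\<And>w. w * (a * a) = (a * a) * w \<Longrightarrow> w * b = b * w"
    by (rule positive_cone_sqrt[OF square_in_positive_cone[OF a]]) blast
  have ab: "a * b = b * a" by (rule b(4)) (simp add: mult.assoc)
  define n where "n = b - a"
  have n: "star n = n" by (simp add: n_def star_diff a b(3))
  have nb: "n * b = b * n" by (simp add: n_def algebra_simps ab)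
  have nn: "n * n = 2 *\<^sub>R (b * n)" by (simp add: n_def algebra_simps ab b(1) scaleR_2)
  have an: "a * n = - (b * n)" by (simp add: n_def algebra_simps ab b(1))
  obtain c where c: "c * c = b" "star c = c" "\<And>w. w * b = b * w \<Longrightarrow> w * c = c * w"
    by (rule positive_cone_sqrt[OF b(2)]) blast
  have nc: "n * c = c * n" by (rule c(3)) (rule nb)
  \<comment> \<open>The root \<open>c\<close> of \<open>b\<close> serves to write
    \<open>b * (n * n)\<close> as a self-adjoint square.\<close>
  define q where "q = c * n"
  have q: "star q = q" by (simp add: q_def star_mult n c(2) nc)
  have qq: "q * q = b * (n * n)"
  proof -
    have "q * q = c * (n * c) * n" by (simp add: q_def mult.assoc)
    also have "\<dots> = (c * c) * (n * n)" by (simp add: nc mult.assoc)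
    finally show ?thesis by (simp add: c(1))
  qed
  have "star (x * n) * (x * n) = n * (a * n)"
    by (simp add: star_mult n x mult.assoc)
  also have "\<dots> = - (q * q)"
    by (simp add: an qq) (simp add: nb flip: mult.assoc)
  finally have y: "star (x * n) * (x * n) = - (q * q)" .
  then have "x * n = 0" using q by (rule eq_0_of_star_mult_self_negative)
  then have "b * (n * n) = 0" using y qq by simp
  moreover have "(n * n) * (n * n) = 2 *\<^sub>R (n * (b * (n * n)))"
    by (subst (1) nn) (simp add: mult.assoc flip: nb)
  ultimately have "(n * n) * (n * n) = 0" by simp
  then have "n * n = 0" by (rule square_eq_0[rotated]) (simp add: star_mult n)
  then have "n = 0" by (rule square_eq_0[OF n])
  then show "a \<in> positive_cone" using b(2) by (simp add: n_def)
qed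

section \<open>Order properties of positive elements and Cauchy-Schwarz inequalities\<close>

lemma positive_mult_star: "positive (x * star x)"
  unfolding positive_def by (metis star_star)

lemma positive_zero: "positive 0"
  using positive_mult_star[of 0] by simp

lemma positive_add: "positive a \<Longrightarrow> positive b \<Longrightarrow> positive (a + b)"
  by (simp add: positive_iff positive_cone_add)

lemma positive_sum: "(\<And>i. i \<in> F \<Longrightarrow> positive (f i)) \<Longrightarrow> positive (\<Sum>i\<in>F. f i)"
  by (induction F rule: infinite_finite_induct) (auto simp: positive_zero positive_add)

lemma positive_scaleR: "positive a \<Longrightarrow> 0 \<le> r \<Longrightarrow> positive (r *\<^sub>R a)"
  by (simp add: positive_iff positive_cone_scaleR)

lemma positive_conjugate:
  assumes "positive a"
  shows "positive (x * a * star x)"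
proof -
  from assms obtain w where "a = star w * w" by (auto simp: positive_def)
  then have "x * a * star x = (x * star w) * star (x * star w)"
    by (simp add: star_mult star_star mult.assoc)
  then show ?thesis by (simp add: positive_mult_star)
qed

lemma positive_norm_diff: "star a = a \<Longrightarrow> norm a \<le> s \<Longrightarrow> positive (s *\<^sub>R 1 - a)"
  by (simp add: positive_iff positive_cone_diff)

lemma positive_norm_mono: "positive a \<Longrightarrow> positive b \<Longrightarrow> norm a \<le> norm (a + b)"
  by (simp add: positive_iff positive_cone_norm_mono)

text \<open>The common core of the Cauchy-Schwarz inequalities in a Hilbert module and in the powers of
  the algebra; \<open>pos\<close> is the positivity of the inner square of \<open>\<beta> f - c g\<close>, where
  \<open>p = \<langle>f,f\<rangle>\<close>, \<open>r = \<langle>g,g\<rangle>\<close> and \<open>c = \<langle>f,g\<rangle>\<close>.\<close>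

lemma norm_inner_le:
  fixes c p r :: "'a::unital_cstar_algebra"
  assumes pos: "positive (\<beta>\<^sup>2 *\<^sub>R p - (2 * \<beta>) *\<^sub>R (c * star c) + c * r * star c)"
    and "star r = r" "norm r \<le> \<beta>" "0 < \<beta>"
  shows "(norm c)\<^sup>2 \<le> \<beta> * norm p"
proof -
  let ?s = "\<beta>\<^sup>2 *\<^sub>R p - (2 * \<beta>) *\<^sub>R (c * star c) + c * r * star c"
  \<comment> \<open>\<open>?d\<close> is positive because \<open>norm r \<le> \<beta>\<close>.
    Adding it to \<open>?s\<close> cancels the term in \<open>r\<close> and one of the two copies of
    \<open>\<beta> c (star c)\<close>; the other is then dominated by
    \<open>\<beta>\<^sup>2 p\<close>.\<close>
  let ?d = "c * (\<beta> *\<^sub>R 1 - r) * star c"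
  have "norm (\<beta> *\<^sub>R (c * star c)) \<le> norm (\<beta> *\<^sub>R (c * star c) + (?s + ?d))"
    using assms(2-4)
    by (intro positive_norm_mono positive_add[OF pos] positive_conjugate positive_norm_diff
        positive_scaleR positive_mult_star) simp_all
  also have "\<beta> *\<^sub>R (c * star c) + (?s + ?d) = \<beta>\<^sup>2 *\<^sub>R p"
  proof -
    have "(2 * \<beta>) *\<^sub>R (c * star c) = \<beta> *\<^sub>R (c * star c) + \<beta> *\<^sub>R (c * star c)"
      by (metis mult_2 scaleR_add_left)
    then show ?thesis by (simp add: algebra_simps)
  qed
  finally have "\<beta> * (norm c)\<^sup>2 \<le> \<beta>\<^sup>2 * norm p"
    using assms by (simp add: norm_mult_star)
  with \<open>0 < \<beta>\<close> show ?thesis by (simp add: power2_eq_square)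
qed

text \<open>\<open>norm_inner_le\<close> in the module of families over \<open>F\<close>. A positive
  upper bound \<open>\<beta>\<close> in place of the norm itself spares the case that all
  \<open>b i\<close> vanish.\<close>

lemma norm_sum_mult_star_le:
  fixes a b :: "'i \<Rightarrow> 'a::unital_cstar_algebra"
  assumes "norm (\<Sum>i\<in>F. b i * star (b i)) \<le> \<beta>" "0 < \<beta>"
  shows "(norm (\<Sum>i\<in>F. a i * star (b i)))\<^sup>2 \<le> \<beta> * norm (\<Sum>i\<in>F. a i * star (a i))"
proof (rule norm_inner_le[OF _ _ assms])
  define c where "c = (\<Sum>i\<in>F. a i * star (b i))"
  have star_c: "star c = (\<Sum>i\<in>F. b i * star (a i))"
    by (simp add: c_def star_sum star_mult star_star)
  have "positive (\<Sum>i\<in>F. (\<beta> *\<^sub>R a i - c * b i) * star (\<beta> *\<^sub>R a i - c * b i))"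
    by (intro positive_sum positive_mult_star)
  also have "(\<Sum>i\<in>F. (\<beta> *\<^sub>R a i - c * b i) * star (\<beta> *\<^sub>R a i - c * b i))
      = (\<Sum>i\<in>F. \<beta>\<^sup>2 *\<^sub>R (a i * star (a i)) - \<beta> *\<^sub>R ((a i * star (b i)) * star c)
          - \<beta> *\<^sub>R (c * (b i * star (a i))) + c * (b i * star (b i)) * star c)"
    by (rule sum.cong)
      (auto simp: star_diff star_scaleR star_mult algebra_simps power2_eq_square)
  also have "\<dots> = \<beta>\<^sup>2 *\<^sub>R (\<Sum>i\<in>F. a i * star (a i)) - \<beta> *\<^sub>R (c * star c) - \<beta> *\<^sub>R (c * star c)
      + c * (\<Sum>i\<in>F. b i * star (b i)) * star c"
    by (simp add: sum.distrib sum_subtractf star_c flip: scaleR_sum_right sum_distrib_left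
        sum_distrib_right c_def)
  also have "\<dots> = \<beta>\<^sup>2 *\<^sub>R (\<Sum>i\<in>F. a i * star (a i)) - (2 * \<beta>) *\<^sub>R (c * star c)
      + c * (\<Sum>i\<in>F. b i * star (b i)) * star c"
  proof -
    have "(2 * \<beta>) *\<^sub>R (c * star c) = \<beta> *\<^sub>R (c * star c) + \<beta> *\<^sub>R (c * star c)"
      by (metis mult_2 scaleR_add_left)
    then show ?thesis by simp
  qed
  finally show "positive (\<beta>\<^sup>2 *\<^sub>R (\<Sum>i\<in>F. a i * star (a i))
      - (2 * \<beta>) *\<^sub>R ((\<Sum>i\<in>F. a i * star (b i)) * star (\<Sum>i\<in>F. a i * star (b i)))
      + (\<Sum>i\<in>F. a i * star (b i)) * (\<Sum>i\<in>F. b i * star (b i)) * star (\<Sum>i\<in>F. a i * star (b i)))"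
    unfolding c_def .
qed (simp add: star_sum star_mult star_star)

text \<open>As \<open>m i\<close> commutes with \<open>v i\<close>, the terms of the two sums differ
  by \<open>v i * (K\<^sup>2 - m i * star (m i)) * star (v i)\<close>, which is positive, and the
  norm is monotone on positive elements.\<close>

lemma norm_sum_center_mult_le:
  fixes m v :: "'i \<Rightarrow> 'a::unital_cstar_algebra"
  assumes "\<And>i. i \<in> F \<Longrightarrow> m i \<in> center" "\<And>i. i \<in> F \<Longrightarrow> norm (m i) \<le> K"
  shows "norm (\<Sum>i\<in>F. (m i * v i) * star (m i * v i)) \<le> K\<^sup>2 * norm (\<Sum>i\<in>F. v i * star (v i))"
proof -
  let ?d = "\<lambda>i. v i * (K\<^sup>2 *\<^sub>R 1 - m i * star (m i)) * star (v i)"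
  have "positive (?d i)" if "i \<in> F" for i
    using assms(2)[OF that]
    by (intro positive_conjugate positive_norm_diff)
      (simp_all add: star_mult star_star norm_mult_star power_mono)
  then have "norm (\<Sum>i\<in>F. (m i * v i) * star (m i * v i))
      \<le> norm ((\<Sum>i\<in>F. (m i * v i) * star (m i * v i)) + (\<Sum>i\<in>F. ?d i))"
    by (intro positive_norm_mono positive_sum positive_mult_star)
  also have "(\<Sum>i\<in>F. (m i * v i) * star (m i * v i)) + (\<Sum>i\<in>F. ?d i)
      = K\<^sup>2 *\<^sub>R (\<Sum>i\<in>F. v i * star (v i))"
    unfolding sum.distrib[symmetric] scaleR_sum_right
  proof (rule sum.cong)
    fix i assume "i \<in> F"
    then have "m i * v i = v i * m i" using assms(1) by (simp add: center_def)
    then show "(m i * v i) * star (m i * v i) + ?d i = K\<^sup>2 *\<^sub>R (v i * star (v i))"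
      by (simp add: star_mult algebra_simps)
  qed simp
  finally show ?thesis by simp
qed

section \<open>Unordered sums and uniform boundedness\<close>

text \<open>By Baire's theorem some \<open>E n\<close> contains a ball. The index set is arbitrary
  because the family will be indexed by the finite subsets of \<open>J\<close>.\<close>

lemma uniform_boundedness:
  fixes T :: "'i \<Rightarrow> 'b::banach \<Rightarrow> 'c::real_normed_vector"
  assumes lin: "\<And>i. i \<in> I \<Longrightarrow> bounded_linear (T i)"
    and pointwise: "\<And>f. \<exists>K. \<forall>i\<in>I. norm (T i f) \<le> K"
  shows "\<exists>K. \<forall>i\<in>I. \<forall>f. norm (T i f) \<le> K * norm f"
proof -
  define E where "E n = {f. \<forall>i\<in>I. norm (T i f) \<le> real n}" for n
  have "closed (E n)" for n
  proof -
    have "E n = (\<Inter>i\<in>I. {f. norm (T i f) \<le> real n})" by (auto simp: E_def)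
    moreover have "closed {f. norm (T i f) \<le> real n}" if "i \<in> I" for i
      by (intro closed_Collect_le continuous_intros bounded_linear.continuous_on[OF lin[OF that]])
    ultimately show ?thesis by auto
  qed
  moreover have "(\<Union>n. E n) = UNIV"
  proof -
    have "\<exists>n. f \<in> E n" for f
    proof -
      obtain K where K: "\<forall>i\<in>I. norm (T i f) \<le> K" using pointwise by blast
      obtain n where "K \<le> real n" using real_arch_simple by blast
      with K have "f \<in> E n" by (fastforce simp: E_def)
      then show ?thesis ..
    qed
    then show ?thesis by blast
  qed
  ultimately have "\<exists>n. interior (E n) \<noteq> {}"
    using Baire_category_alt[of "euclidean :: 'b topology" "range E"]
    by (auto simp: completely_metrizable_space_euclidean)
  then obtain n x where "x \<in> interior (E n)" by blast
  then obtain e where e: "e > 0" "ball x e \<subseteq> E n" by (meson mem_interior)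
  show ?thesis
  proof (intro exI ballI allI)
    fix i f assume i: "i \<in> I"
    interpret T: bounded_linear "T i" using i by (rule lin)
    show "norm (T i f) \<le> (4 * real n / e) * norm f"
    proof (cases "f = 0")
      case True
      then show ?thesis by (simp add: T.zero)
    next
      case False
      \<comment> \<open>\<open>r f\<close> has norm \<open>e / 2\<close>, so \<open>x + r f\<close>
        stays in the ball. Dividing a difference of two values of norm at most \<open>n\<close> by
        \<open>r\<close> gives the constant \<open>4 n / e\<close>.\<close>
      define r where "r = e / (2 * norm f)"
      have r: "r > 0" using e False by (simp add: r_def)
      have "x + r *\<^sub>R f \<in> ball x e" "x \<in> ball x e"
        using e False by (simp_all add: dist_norm r_def)
      then have "x + r *\<^sub>R f \<in> E n" "x \<in> E n"
        using e(2) by blast+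
      then have "norm (T i (x + r *\<^sub>R f)) \<le> real n" "norm (T i x) \<le> real n"
        using i by (simp_all add: E_def)
      then have "norm (T i (x + r *\<^sub>R f) - T i x) \<le> 2 * real n"
        by norm
      then have "r * norm (T i f) \<le> 2 * real n"
        using r by (simp add: T.add T.scaleR)
      then show ?thesis using e False by (simp add: r_def field_simps)
    qed
  qed
qed

text \<open>A sum over \<open>F\<close> is one over \<open>F \<union> F0\<close>, which is within 1
  of the limit, minus one over a part of the fixed finite set \<open>F0\<close>.\<close>

lemma summable_on_bounded_sums:
  fixes f :: "'i \<Rightarrow> 'b::real_normed_vector"
  assumes "f summable_on J"
  obtains K where "\<And>F. finite F \<Longrightarrow> F \<subseteq> J \<Longrightarrow> norm (sum f F) \<le> K"
proof -
  from assms obtain S where "(sum f \<longlongrightarrow> S) (finite_subsets_at_top J)"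
    by (auto simp: summable_on_def has_sum_def)
  then have "eventually (\<lambda>F. dist (sum f F) S < 1) (finite_subsets_at_top J)"
    by (rule tendstoD) simp
  then obtain F0 where F0: "finite F0" "F0 \<subseteq> J"
    "\<And>F. finite F \<Longrightarrow> F0 \<subseteq> F \<Longrightarrow> F \<subseteq> J \<Longrightarrow> dist (sum f F) S < 1"
    by (auto simp: eventually_finite_subsets_at_top)
  show ?thesis
  proof (rule that)
    fix F assume F: "finite F" "F \<subseteq> J"
    have "sum f (F \<union> F0) = sum f F + sum f (F0 - F)"
      using F F0 by (subst sum.union_disjoint[symmetric]) (auto intro: arg_cong[of _ _ "sum f"])
    moreover have "norm (sum f (F0 - F)) \<le> (\<Sum>i\<in>F0. norm (f i))"
      using F0(1) by (intro order_trans[OF norm_sum sum_mono2]) auto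
    moreover have "dist (sum f (F \<union> F0)) S < 1" using F F0 by (intro F0(3)) auto
    ultimately show "norm (sum f F) \<le> norm S + 1 + (\<Sum>i\<in>F0. norm (f i))"
      using norm_triangle_ineq4[of "sum f (F \<union> F0)" "sum f (F0 - F)"]
        norm_triangle_sub[of "sum f (F \<union> F0)" S]
      by (simp add: dist_norm)
  qed
qed

text \<open>The Cauchy criterion is stated for finite sets disjoint from \<open>F0\<close>, because
  the multiplier series will be compared with a positive series over the same finite set.\<close>

lemma summable_on_Cauchy:
  fixes f :: "'i \<Rightarrow> 'b::banach"
  shows "f summable_on J \<longleftrightarrow>
    (\<forall>e>0. \<exists>F0. finite F0 \<and> F0 \<subseteq> J \<and> (\<forall>F. finite F \<and> F \<subseteq> J - F0 \<longrightarrow> norm (sum f F) < e))"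
proof safe
  fix e :: real assume "f summable_on J" "e > 0"
  then obtain S where "(sum f \<longlongrightarrow> S) (finite_subsets_at_top J)"
    by (auto simp: summable_on_def has_sum_def)
  then have "eventually (\<lambda>F. dist (sum f F) S < e / 2) (finite_subsets_at_top J)"
    by (rule tendstoD) (use \<open>e > 0\<close> in simp)
  then obtain F0 where F0: "finite F0" "F0 \<subseteq> J"
    "\<And>F. finite F \<Longrightarrow> F0 \<subseteq> F \<Longrightarrow> F \<subseteq> J \<Longrightarrow> dist (sum f F) S < e / 2"
    by (auto simp: eventually_finite_subsets_at_top)
  show "\<exists>F0. finite F0 \<and> F0 \<subseteq> J \<and> (\<forall>F. finite F \<and> F \<subseteq> J - F0 \<longrightarrow> norm (sum f F) < e)"
  proof (intro exI conjI allI impI)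
    fix F assume F: "finite F \<and> F \<subseteq> J - F0"
    then have "sum f (F \<union> F0) = sum f F + sum f F0"
      using F0 by (intro sum.union_disjoint) auto
    moreover have "dist (sum f (F \<union> F0)) S < e / 2" "dist (sum f F0) S < e / 2"
      using F F0(1,2) by (intro F0(3); auto)+
    ultimately show "norm (sum f F) < e"
      using dist_triangle_half_l[of "sum f (F \<union> F0)" S e "sum f F0"] by (simp add: dist_norm)
  qed (use F0 in auto)
next
  assume *: "\<forall>e>0. \<exists>F0. finite F0 \<and> F0 \<subseteq> J \<and>
    (\<forall>F. finite F \<and> F \<subseteq> J - F0 \<longrightarrow> norm (sum f F) < e)"
  have "cauchy_filter (filtermap (sum f) (finite_subsets_at_top J))"
    unfolding cauchy_filter_metric_filtermap
  proof (intro allI impI)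
    fix e :: real assume "e > 0"
    then obtain F0 where F0: "finite F0" "F0 \<subseteq> J"
      "\<And>F. finite F \<Longrightarrow> F \<subseteq> J - F0 \<Longrightarrow> norm (sum f F) < e / 2"
      using *[rule_format, of "e / 2"] by auto
    define P where "P F \<longleftrightarrow> finite F \<and> F0 \<subseteq> F \<and> F \<subseteq> J" for F
    have near: "dist (sum f F) (sum f F0) < e / 2" if "P F" for F
    proof -
      have "sum f F = sum f F0 + sum f (F - F0)"
        using sum.subset_diff[of F0 F f] that by (simp add: P_def add.commute)
      moreover have "norm (sum f (F - F0)) < e / 2"
        using that by (intro F0(3)) (auto simp: P_def)
      ultimately show ?thesis by (simp add: dist_norm)
    qed
    have "eventually P (finite_subsets_at_top J)"
      using F0 by (auto simp: eventually_finite_subsets_at_top P_def)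
    moreover have "dist (sum f F) (sum f F') < e" if "P F" "P F'" for F F'
      using near[OF that(1)] near[OF that(2)] by (rule dist_triangle_half_l)
    ultimately show "\<exists>P. eventually P (finite_subsets_at_top J) \<and>
        (\<forall>x y. P x \<and> P y \<longrightarrow> dist (sum f x) (sum f y) < e)"
      by blast
  qed
  then obtain S where "filtermap (sum f) (finite_subsets_at_top J) \<le> nhds S"
    using cauchy_filter_complete_converges[of "filtermap (sum f) (finite_subsets_at_top J)" UNIV]
      complete_UNIV by (auto simp: filtermap_bot_iff)
  then show "f summable_on J"
    by (auto simp: summable_on_def has_sum_def filterlim_def)
qed

lemma norm_infsum_le_of_sums:
  fixes f :: "'i \<Rightarrow> 'b::real_normed_vector"
  assumes "f summable_on J" "\<And>F. finite F \<Longrightarrow> F \<subseteq> J \<Longrightarrow> norm (sum f F) \<le> K"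
  shows "norm (infsum f J) \<le> K"
proof (rule tendsto_upperbound)
  show "((\<lambda>F. norm (sum f F)) \<longlongrightarrow> norm (infsum f J)) (finite_subsets_at_top J)"
    using assms(1) by (intro tendsto_norm infsum_tendsto)
  show "eventually (\<lambda>F. norm (sum f F) \<le> K) (finite_subsets_at_top J)"
    using assms(2) by (auto intro: eventually_finite_subsets_at_top_weakI)
qed simp

section \<open>Hilbert modules\<close>

context hilbert_module
begin

text \<open>Makes complex and real homogeneity special cases of \<open>A\<close>-linearity.\<close>

lemma act_scaleC_one: "act (c *\<^sub>C 1) f = c *\<^sub>C f"
  by (simp add: act_scaleC_left act_one)

lemma ip_scaleC_left: "ip (c *\<^sub>C f) g = c *\<^sub>C ip f g"
  unfolding act_scaleC_one[symmetric] by (simp add: ip_act_left scaleC_mult_left)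

lemma ip_scaleR_left: "ip (r *\<^sub>R f) g = r *\<^sub>R ip f g"
  by (simp add: ip_scaleC_left flip: scaleC_of_real)

lemma ip_add_right: "ip f (g + h) = ip f g + ip f h"
  using ip_star[of "g + h" f] by (simp add: ip_add_left star_add ip_star)

lemma ip_act_right: "ip f (act a g) = ip f g * star a"
  using ip_star[of "act a g" f] by (simp add: ip_act_left star_mult ip_star)

lemma ip_scaleC_right: "ip f (c *\<^sub>C g) = cnj c *\<^sub>C ip f g"
  using ip_star[of "c *\<^sub>C g" f] by (simp add: ip_scaleC_left star_scaleC ip_star)

lemma ip_scaleR_right: "ip f (r *\<^sub>R g) = r *\<^sub>R ip f g"
  using ip_star[of "r *\<^sub>R g" f] by (simp add: ip_scaleR_left star_scaleR ip_star)

lemma ip_minus_left: "ip (- f) g = - ip f g"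
  using ip_scaleR_left[of "-1" f g] by simp

lemma ip_minus_right: "ip f (- g) = - ip f g"
  using ip_scaleR_right[of f "-1" g] by simp

lemma ip_diff_left: "ip (f - g) h = ip f h - ip g h"
  using ip_add_left[of f "- g" h] by (simp add: ip_minus_left)

lemma ip_diff_right: "ip f (g - h) = ip f g - ip f h"
  using ip_add_right[of f g "- h"] by (simp add: ip_minus_right)

lemma norm_ip_self: "norm (ip f f) = (norm f)\<^sup>2"
  by (simp add: norm_eq)

lemma ip_zero_right [simp]: "ip f 0 = 0"
  using ip_scaleR_right[of f 0 0] by simp

lemma norm_ip_le: "norm (ip f g) \<le> norm f * norm g"
proof (cases "g = 0")
  case False
  let ?\<beta> = "(norm g)\<^sup>2" and ?c = "ip f g"
  have "positive (ip (?\<beta> *\<^sub>R f - act ?c g) (?\<beta> *\<^sub>R f - act ?c g))"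
    by (rule ip_positive)
  also have "ip (?\<beta> *\<^sub>R f - act ?c g) (?\<beta> *\<^sub>R f - act ?c g)
      = ?\<beta>\<^sup>2 *\<^sub>R ip f f - (2 * ?\<beta>) *\<^sub>R (?c * star ?c) + ?c * ip g g * star ?c"
  proof -
    have "(2 * ?\<beta>) *\<^sub>R (?c * star ?c) = ?\<beta> *\<^sub>R (?c * star ?c) + ?\<beta> *\<^sub>R (?c * star ?c)"
      by (metis mult_2 scaleR_add_left)
    then show ?thesis
      by (simp add: ip_diff_left ip_diff_right ip_scaleR_left ip_scaleR_right ip_act_left
          ip_act_right ip_star algebra_simps power2_eq_square)
  qed
  finally have "(norm ?c)\<^sup>2 \<le> ?\<beta> * norm (ip f f)"
    by (rule norm_inner_le) (use False in \<open>simp_all add: ip_star norm_ip_self\<close>)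
  then have "(norm ?c)\<^sup>2 \<le> (norm f * norm g)\<^sup>2"
    by (simp add: norm_ip_self power_mult_distrib mult.commute)
  then show ?thesis by (rule power2_le_imp_le) simp
qed simp

lemma bounded_linear_ip_left: "bounded_linear (\<lambda>f. ip f g)"
  by (rule bounded_linear_intro[where K = "norm g"])
    (auto simp: ip_add_left ip_scaleR_left norm_ip_le)

lemmas ip_sum_left = linear_sum[OF bounded_linear.linear[OF bounded_linear_ip_left]]

text \<open>The sort of \<open>'h\<close> relates the norm to real scalars only; the effect of
  \<open>i\<close> is read off the inner product.\<close>

lemma norm_scaleC_i: "norm (\<i> *\<^sub>C f) = norm (f :: 'h)"
  by (simp add: norm_eq ip_scaleC_left ip_scaleC_right norm_scaleC)

lemma norm_act_le: "norm (act a f) \<le> norm a * norm f"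
proof -
  have "(norm (act a f))\<^sup>2 = norm (a * ip f f * star a)"
    by (simp add: ip_act_left ip_act_right mult.assoc flip: norm_ip_self)
  also have "\<dots> \<le> norm (a * ip f f) * norm (star a)"
    by (rule norm_mult_ineq)
  also have "\<dots> \<le> (norm a * norm (ip f f)) * norm a"
    by (simp add: mult_right_mono norm_mult_ineq)
  also have "\<dots> = (norm a * norm f)\<^sup>2"
    by (simp add: norm_ip_self power2_eq_square)
  finally show ?thesis by (rule power2_le_imp_le) simp
qed

lemma bounded_linear_act_right: "bounded_linear (act a)"
  by (rule bounded_linear_intro[where K = "norm a"])
    (auto simp: act_add_right act_scaleC_right norm_act_le mult.commute[of _ "norm a"]
      simp flip: scaleC_of_real)

lemma bounded_linear_act_left: "bounded_linear (\<lambda>a. act a f)"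
  by (rule bounded_linear_intro[where K = "norm f"])
    (auto simp: act_add_left act_scaleC_left norm_act_le simp flip: scaleC_of_real)

lemma bounded_linear_scaleC_i: "bounded_linear (\<lambda>f :: 'h. \<i> *\<^sub>C f)"
  by (rule bounded_linear_intro[where K = 1])
    (auto simp: scaleC_add_right norm_scaleC_i scaleC_scaleC mult.commute simp flip: scaleC_of_real)

end

section \<open>Invertibility of the adjoint\<close>

text \<open>Solutions of \<open>L x + E x = y\<close> arise as fixed points of
  \<open>x \<mapsto> R (y - E x)\<close> for a right inverse \<open>R\<close> of \<open>L\<close>.
  The lower bound on \<open>L\<close> makes this map a contraction with ratio
  \<open>\<eta> / \<delta>\<close>.\<close>

lemma surj_add_small:
  fixes L E :: "'b::banach \<Rightarrow> 'b"
  assumes L: "bounded_linear L" "surj L" "\<And>x. \<delta> * norm x \<le> norm (L x)"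
    and E: "bounded_linear E" "\<And>x. norm (E x) \<le> \<eta> * norm x"
    and "0 \<le> \<eta>" "\<eta> < \<delta>"
  shows "surj (\<lambda>x. L x + E x)"
  unfolding surj_def
proof
  fix y
  define R where "R = inv L"
  have LR: "L (R u) = u" for u using L(2) by (simp add: R_def surj_f_inv_f)
  have "dist (R (y - E u)) (R (y - E v)) \<le> (\<eta> / \<delta>) * dist u v" for u v
  proof -
    have "\<delta> * norm (R (y - E u) - R (y - E v)) \<le> norm (L (R (y - E u) - R (y - E v)))"
      by (rule L(3))
    also have "\<dots> = norm (E (v - u))"
      by (simp add: linear_diff[OF bounded_linear.linear[OF L(1)]]
          linear_diff[OF bounded_linear.linear[OF E(1)]] LR)
    also have "\<dots> \<le> \<eta> * norm (v - u)" by (rule E(2))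
    finally have "norm (R (y - E u) - R (y - E v)) * \<delta> \<le> \<eta> * norm (u - v)"
      by (simp add: mult.commute norm_minus_commute)
    then show ?thesis
      using assms(6,7) by (simp add: dist_norm pos_le_divide_eq)
  qed
  moreover have "0 \<le> \<eta> / \<delta>" "\<eta> / \<delta> < 1" using assms(6,7) by auto
  ultimately have "\<exists>!x. R (y - E x) = x" by (intro banach_fix_type) auto
  then obtain x where "R (y - E x) = x" by blast
  then have "L x = y - E x" using LR[of "y - E x"] by simp
  then show "\<exists>x. y = L x + E x" by (intro exI[of _ x]) simp
qed

context hilbert_module
begin

text \<open>Continuity method: the operators \<open>P + i t\<close> are bounded below uniformly in the real number
  \<open>t\<close> and surjective for large \<open>t\<close>, so surjectivity propagates in small steps down to \<open>t = 0\<close>.\<close>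

lemma surj_self_adjoint:
  fixes P :: "'h \<Rightarrow> 'h"
  assumes P: "bounded_linear P" and below: "\<And>f. c * norm f \<le> norm (P f)" and "0 < c"
    and sa: "\<And>f. star (ip (P f) f) = ip (P f) f"
  shows "surj P"
proof -
  define E where "E t f = t *\<^sub>R (\<i> *\<^sub>C f)" for t and f :: 'h
  have E: "bounded_linear (E t)" for t
    unfolding E_def by (rule bounded_linear_compose[OF bounded_linear_scaleR_right bounded_linear_scaleC_i])
  have norm_E: "norm (E t f) = \<bar>t\<bar> * norm f" for t f
    by (simp add: E_def norm_scaleC_i)
  \<comment> \<open>For large \<open>t\<close> the skew-adjoint part
    \<open>i t \<langle>f,f\<rangle>\<close> of the inner product of \<open>P f + i t f\<close> with
    \<open>f\<close> gives the bound; for small \<open>t\<close> the term \<open>i t f\<close> takes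
    away at most half of the lower bound of \<open>P\<close>.\<close>
  have below_t: "c / 2 * norm f \<le> norm (P f + E t f)" for t f
  proof (cases "\<bar>t\<bar> \<ge> c / 2")
    case True
    let ?z = "ip (P f + E t f) f"
    have z: "?z = ip (P f) f + t *\<^sub>R (\<i> *\<^sub>C ip f f)"
      by (simp add: E_def ip_add_left ip_scaleR_left ip_scaleC_left)
    have "?z - star ?z = (2 * t) *\<^sub>R (\<i> *\<^sub>C ip f f)"
      unfolding z
      by (simp add: star_add star_scaleR star_scaleC sa ip_star[of f f] scaleC_minus_left
          flip: scaleR_2)
    then have "2 * \<bar>t\<bar> * (norm f)\<^sup>2 = norm (?z - star ?z)"
      by (simp add: norm_scaleC norm_ip_self abs_mult)
    also have "\<dots> \<le> 2 * norm ?z"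
      using norm_triangle_ineq4[of ?z "star ?z"] by simp
    also have "\<dots> \<le> 2 * (norm (P f + E t f) * norm f)"
      using norm_ip_le[of "P f + E t f" f] by simp
    finally have "\<bar>t\<bar> * norm f * norm f \<le> norm (P f + E t f) * norm f"
      by (simp add: power2_eq_square)
    then have "\<bar>t\<bar> * norm f \<le> norm (P f + E t f)"
      by (cases "f = 0") auto
    moreover have "c / 2 * norm f \<le> \<bar>t\<bar> * norm f" using True by (intro mult_right_mono) auto
    ultimately show ?thesis by linarith
  next
    case False
    then have "\<bar>t\<bar> * norm f \<le> c / 2 * norm f" by (intro mult_right_mono) auto
    moreover have "norm (P f) - norm (E t f) \<le> norm (P f + E t f)"
      by (rule norm_diff_ineq)
    ultimately show ?thesis using below[of f] by (simp add: norm_E)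
  qed
  obtain K where K: "K > 0" "\<And>f. norm (P f) \<le> norm f * K"
    using bounded_linear.pos_bounded[OF P] by blast
  \<comment> \<open>Since \<open>s\<close> exceeds the bound \<open>K\<close> of \<open>P\<close>,
    the operator \<open>P + i s\<close> is a small perturbation of the bijection \<open>i s\<close>.
    The step length \<open>s / N\<close> has to stay below the uniform lower bound
    \<open>c / 2\<close>.\<close>
  define s where "s = K + 1"
  obtain N :: nat where N: "N > 0" "s / real N < c / 2"
  proof -
    obtain N :: nat where "2 * s / c < real N" using reals_Archimedean2 by blast
    moreover have "2 * s / c > 0" using K(1) \<open>0 < c\<close> by (simp add: s_def)
    ultimately have "N > 0" by (intro gr0I) auto
    moreover have "2 * s < c * real N"
      using \<open>2 * s / c < real N\<close> \<open>0 < c\<close> by (simp add: pos_divide_less_eq mult.commute)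
    ultimately show ?thesis by (intro that) (auto simp: pos_divide_less_eq)
  qed
  have "surj (\<lambda>f. P f + E (s - real n * (s / real N)) f)" for n
  proof (induction n)
    case 0
    have "E s ((1 / s) *\<^sub>R (- (\<i> *\<^sub>C f))) = f" for f
      using K(1) by (simp add: E_def s_def scaleC_minus_right scaleC_i_i
          linear_cmul[OF bounded_linear.linear[OF bounded_linear_scaleC_i]])
    then have "surj (E s)" by (rule surjI)
    then have "surj (\<lambda>f. E s f + P f)"
      by (rule surj_add_small[where \<delta> = s and \<eta> = K, OF E _ _ P])
        (use K in \<open>auto simp: norm_E s_def mult.commute\<close>)
    then show ?case by (simp add: add.commute)
  next
    case (Suc n)
    let ?t = "s - real n * (s / real N)"
    have "surj (\<lambda>f. (P f + E ?t f) + E (- (s / real N)) f)"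
      by (rule surj_add_small[where \<delta> = "c / 2" and \<eta> = "s / real N",
            OF bounded_linear_add[OF P E] Suc below_t E])
        (use N K(1) in \<open>auto simp: norm_E s_def\<close>)
    moreover have "s - real (Suc n) * (s / real N) = ?t + - (s / real N)"
      by (simp add: distrib_right add_divide_distrib)
    then have "E ?t f + E (- (s / real N)) f = E (s - real (Suc n) * (s / real N)) f" for f
      unfolding E_def by (simp only: scaleR_add_left)
    ultimately show ?case by (simp add: add.assoc)
  qed
  from this[of N] show ?thesis using N(1) by (simp add: E_def)
qed

text \<open>The adjoint of the inverse of \<open>C\<close> would invert \<open>T\<close>, but its
  existence is not known beforehand. Instead, \<open>T \<circ> C\<close> is self-adjoint, and
  bounded below as both factors are, hence surjective.\<close>

lemma surj_adjoint:
  assumes C: "C \<in> GL act" and adj: "\<And>f g. ip (C f) g = ip f (T g)"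
  shows "surj T"
proof -
  from C obtain D where lin: "bounded_linear C" "bounded_linear D"
    and DC: "\<And>f. D (C f) = f" and CD: "\<And>f. C (D f) = f"
    by (auto simp: GL_def bounded_module_operator_def fun_eq_iff)
  obtain K where K: "K > 0" "\<And>f. norm (C f) \<le> norm f * K"
    using bounded_linear.pos_bounded[OF lin(1)] by blast
  obtain L where L: "L > 0" "\<And>f. norm (D f) \<le> norm f * L"
    using bounded_linear.pos_bounded[OF lin(2)] by blast
  have eqI: "g = h" if "\<And>f. ip f g = ip f h" for g h
    using ip_definite[of "g - h"] that[of "g - h"] by (simp add: ip_diff_right)
  have "bounded_linear T"
  proof (rule bounded_linear_intro)
    show "T (g + h) = T g + T h" for g h
      by (rule eqI) (simp add: ip_add_right flip: adj)
    show "T (r *\<^sub>R g) = r *\<^sub>R T g" for r g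
      by (rule eqI) (simp add: ip_scaleR_right flip: adj)
    show "norm (T g) \<le> norm g * K" for g
    proof -
      have "norm (T g) * norm (T g) = norm (ip (C (T g)) g)"
        by (simp add: adj norm_ip_self power2_eq_square)
      also have "\<dots> \<le> norm (C (T g)) * norm g" by (rule norm_ip_le)
      also have "\<dots> \<le> (norm (T g) * K) * norm g" by (intro mult_right_mono K) simp
      finally have "norm (T g) * norm (T g) \<le> norm (T g) * (norm g * K)"
        by (simp add: algebra_simps)
      then show ?thesis using K(1) by (cases "T g = 0") auto
    qed
  qed
  have below: "norm g \<le> L * norm (T g)" for g
  proof -
    have "norm g * norm g = norm (ip (C (D g)) g)"
      by (simp add: CD norm_ip_self power2_eq_square)
    also have "\<dots> = norm (ip (D g) (T g))" by (simp add: adj)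
    also have "\<dots> \<le> norm (D g) * norm (T g)" by (rule norm_ip_le)
    also have "\<dots> \<le> (norm g * L) * norm (T g)" by (intro mult_right_mono L) simp
    finally have "norm g * norm g \<le> norm g * (L * norm (T g))"
      by (simp add: algebra_simps)
    then show ?thesis using L(1) by (cases "g = 0") auto
  qed
  have "surj (\<lambda>f. T (C f))"
  proof (rule surj_self_adjoint)
    show "bounded_linear (\<lambda>f. T (C f))"
      using \<open>bounded_linear T\<close> lin(1) by (rule bounded_linear_compose)
    show "0 < 1 / (L * L)" using L(1) by simp
    show "1 / (L * L) * norm f \<le> norm (T (C f))" for f
    proof -
      have "norm f \<le> norm (C f) * L" using L(2)[of "C f"] by (simp add: DC)
      also have "\<dots> \<le> (L * norm (T (C f))) * L"
        using L(1) by (intro mult_right_mono below) simp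
      finally show ?thesis using L(1) by (simp add: field_simps)
    qed
    show "star (ip (T (C f)) f) = ip (T (C f)) f" for f
    proof -
      have "ip (T (C f)) f = star (ip (C f) (C f))"
        by (simp only: adj ip_star)
      then show ?thesis by (simp add: ip_star)
    qed
  qed
  then show ?thesis by (auto simp: surj_def)
qed

end

section \<open>Controlled Bessel sequences\<close>

context hilbert_module
begin

text \<open>By polarization.\<close>

lemma controlled_bessel_summable:
  fixes C :: "'h \<Rightarrow> 'h"
  assumes \<psi>: "controlled_bessel ip C J \<psi>"
  shows "(\<lambda>j. ip f (\<psi> j) * ip (C (\<psi> j)) g) summable_on J"
proof -
  let ?q = "\<lambda>h j. ip h (\<psi> j) * ip (C (\<psi> j)) h"
  have q: "?q h summable_on J" for h
    using \<psi> by (auto simp: controlled_bessel_def)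
  have lin: "bounded_linear (\<lambda>x :: 'a. \<i> *\<^sub>C x)"
    by (rule bounded_linear_intro[where K = 1])
      (auto simp: scaleC_add_right norm_scaleC scaleC_scaleC mult.commute simp flip: scaleC_of_real)
  have "(\<lambda>j. (1/4) *\<^sub>R ((?q (f + g) j - ?q (f - g) j)
      + \<i> *\<^sub>C (?q (f + \<i> *\<^sub>C g) j - ?q (f - \<i> *\<^sub>C g) j))) summable_on J"
    unfolding diff_conv_add_uminus
    by (intro summable_on_scaleR_right summable_on_add summable_on_uminus[THEN iffD2]
        summable_on_bounded_linear[OF lin] q[unfolded diff_conv_add_uminus])
  also have "(\<lambda>j. (1/4) *\<^sub>R ((?q (f + g) j - ?q (f - g) j)
      + \<i> *\<^sub>C (?q (f + \<i> *\<^sub>C g) j - ?q (f - \<i> *\<^sub>C g) j)))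
      = (\<lambda>j. ip f (\<psi> j) * ip (C (\<psi> j)) g)"
  proof
    fix j
    have "(?q (f + g) j - ?q (f - g) j) + \<i> *\<^sub>C (?q (f + \<i> *\<^sub>C g) j - ?q (f - \<i> *\<^sub>C g) j)
        = 4 *\<^sub>R (ip f (\<psi> j) * ip (C (\<psi> j)) g)"
    proof -
      have four: "4 *\<^sub>R x = x + x + x + x" for x :: 'a
        using scaleR_add_left[of 2 2 x] by (simp add: scaleR_2)
      show ?thesis
        unfolding four
        by (simp add: ip_add_left ip_add_right ip_diff_left ip_diff_right ip_scaleC_left
            ip_scaleC_right scaleC_simps algebra_simps)
    qed
    then show "(1/4) *\<^sub>R ((?q (f + g) j - ?q (f - g) j)
      + \<i> *\<^sub>C (?q (f + \<i> *\<^sub>C g) j - ?q (f - \<i> *\<^sub>C g) j)) = ip f (\<psi> j) * ip (C (\<psi> j)) g"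
      by simp
  qed
  finally show ?thesis .
qed

text \<open>The partial sums \<open>T F\<close> of the controlled frame operator are uniformly bounded, hence so are
  those of the frame operator, which are \<open>C\<^sup>-\<^sup>1 \<circ> T F\<close>.\<close>

lemma controlled_bessel_bound:
  fixes C :: "'h \<Rightarrow> 'h"
  assumes C: "C \<in> GL act" and \<psi>: "controlled_bessel ip C J \<psi>"
  shows "\<exists>B>0. \<forall>F f. finite F \<longrightarrow> F \<subseteq> J \<longrightarrow>
    norm (\<Sum>j\<in>F. ip f (\<psi> j) * ip (\<psi> j) f) \<le> B * (norm f)\<^sup>2"
proof -
  from C obtain D where lin: "bounded_linear D" and D_act: "\<And>a f. D (act a f) = act a (D f)"
    and DC: "\<And>f. D (C f) = f"
    by (auto simp: GL_def bounded_module_operator_def fun_eq_iff)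
  obtain L where L: "L > 0" "\<And>f. norm (D f) \<le> norm f * L"
    using bounded_linear.pos_bounded[OF lin] by blast
  define I where "I = {F. finite F \<and> F \<subseteq> J}"
  define T where "T F f = (\<Sum>j\<in>F. act (ip f (\<psi> j)) (C (\<psi> j)))" for F f
  have T_lin: "bounded_linear (T F)" for F
    unfolding T_def
    by (intro bounded_linear_sum bounded_linear_compose[OF bounded_linear_act_left
          bounded_linear_ip_left])
  \<comment> \<open>Uniform boundedness is used twice: here for fixed \<open>f\<close>, on the
    functionals \<open>g \<mapsto> \<langle>g, T F f\<rangle>\<close>, where
    \<open>g = T F f\<close> yields a bound on \<open>T F f\<close>; afterwards on the operators
    \<open>T F\<close> themselves.\<close>
  have "\<exists>K. \<forall>F\<in>I. norm (T F f) \<le> K" for f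
  proof -
    have "\<exists>K. \<forall>F\<in>I. norm (ip g (T F f)) \<le> K" for g
    proof -
      obtain K where K: "\<And>F. finite F \<Longrightarrow> F \<subseteq> J \<Longrightarrow>
          norm (\<Sum>j\<in>F. ip f (\<psi> j) * ip (C (\<psi> j)) g) \<le> K"
        by (rule summable_on_bounded_sums[OF controlled_bessel_summable[OF \<psi>, of f g]]) blast
      have "ip (T F f) g = (\<Sum>j\<in>F. ip f (\<psi> j) * ip (C (\<psi> j)) g)" for F
        by (simp add: T_def ip_sum_left ip_act_left)
      moreover have "norm (ip g (T F f)) = norm (ip (T F f) g)" for F
        unfolding ip_star[of "T F f" g, symmetric] by (rule norm_star)
      ultimately show ?thesis using K by (intro exI[of _ K]) (auto simp: I_def)
    qed
    then have "\<exists>K. \<forall>F\<in>I. \<forall>g. norm (ip g (T F f)) \<le> K * norm g"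
    proof -
      have "bounded_linear (\<lambda>g. ip g (T F f))" for F by (rule bounded_linear_ip_left)
      then show ?thesis
        using \<open>\<And>g. \<exists>K. \<forall>F\<in>I. norm (ip g (T F f)) \<le> K\<close> by (rule uniform_boundedness)
    qed
    then obtain K where K: "\<And>F g. F \<in> I \<Longrightarrow> norm (ip g (T F f)) \<le> K * norm g" by blast
    have "norm (T F f) \<le> max K 0" if "F \<in> I" for F
    proof (cases "T F f = 0")
      case False
      then show ?thesis
        using K[OF that, of "T F f"] by (simp add: norm_ip_self power2_eq_square)
    qed simp
    then show ?thesis by blast
  qed
  with T_lin have "\<exists>K. \<forall>F\<in>I. \<forall>f. norm (T F f) \<le> K * norm f"
    by (rule uniform_boundedness)
  then obtain K where K: "\<And>F f. F \<in> I \<Longrightarrow> norm (T F f) \<le> K * norm f" by blast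
  show ?thesis
  proof (intro exI conjI allI impI)
    show "0 < \<bar>K\<bar> * L + 1" using L(1) by (simp add: add_nonneg_pos)
    fix F f assume "finite F" "F \<subseteq> J"
    have "(\<Sum>j\<in>F. ip f (\<psi> j) * ip (\<psi> j) f) = ip (D (T F f)) f"
      by (simp add: T_def linear_sum[OF bounded_linear.linear[OF lin]] D_act DC ip_sum_left
          ip_act_left)
    then have "norm (\<Sum>j\<in>F. ip f (\<psi> j) * ip (\<psi> j) f) \<le> norm (D (T F f)) * norm f"
      by (simp add: norm_ip_le)
    also have "\<dots> \<le> (norm (T F f) * L) * norm f" by (intro mult_right_mono L) simp
    also have "\<dots> \<le> ((\<bar>K\<bar> * norm f) * L) * norm f"
    proof -
      have "norm (T F f) \<le> K * norm f"
        using \<open>finite F\<close> \<open>F \<subseteq> J\<close> by (intro K) (simp add: I_def)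
      also have "\<dots> \<le> \<bar>K\<bar> * norm f" by (simp add: mult_right_mono)
      finally show ?thesis using L(1) by (intro mult_right_mono) simp_all
    qed
    also have "\<dots> \<le> (\<bar>K\<bar> * L + 1) * (norm f)\<^sup>2"
      by (simp add: power2_eq_square algebra_simps)
    finally show "norm (\<Sum>j\<in>F. ip f (\<psi> j) * ip (\<psi> j) f) \<le> (\<bar>K\<bar> * L + 1) * (norm f)\<^sup>2" .
  qed
qed

text \<open>Norm-bounded sums of positive elements need not converge in a C*-algebra, so
  \<open>controlled_bessel_bound\<close> alone does not give this.\<close>

lemma controlled_bessel_square_summable:
  fixes C :: "'h \<Rightarrow> 'h"
  assumes C: "C \<in> GL act" and \<psi>: "controlled_bessel ip C J \<psi>"
    and "adjointable ip C \<or> controlled_frame_operator_converges act ip C J \<psi>"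
  shows "(\<lambda>j. ip f (\<psi> j) * ip (\<psi> j) f) summable_on J"
  using assms(3)
proof
  assume "adjointable ip C"
  then obtain T where T: "\<And>f g. ip (C f) g = ip f (T g)" by (auto simp: adjointable_def)
  obtain g where "T g = f" using surj_adjoint[OF C T] by (metis surjD)
  with controlled_bessel_summable[OF \<psi>, of f g] show ?thesis by (simp add: T)
next
  assume "controlled_frame_operator_converges act ip C J \<psi>"
  then have *: "(\<lambda>j. act (ip f (\<psi> j)) (C (\<psi> j))) summable_on J"
    by (simp add: controlled_frame_operator_converges_def)
  from C obtain D where lin: "bounded_linear D" and D: "\<And>a f. D (act a f) = act a (D f)"
    "\<And>f. D (C f) = f"
    by (auto simp: GL_def bounded_module_operator_def fun_eq_iff)
  have "(\<lambda>j. ip (D (act (ip f (\<psi> j)) (C (\<psi> j)))) f) summable_on J"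
    by (intro summable_on_bounded_linear[OF bounded_linear_ip_left]
        summable_on_bounded_linear[OF lin] *)
  then show ?thesis by (simp add: D ip_act_left)
qed

text \<open>Synthesis is bounded because it is dual to analysis: for the sum \<open>g\<close>, the
  inner product \<open>\<langle>g,g\<rangle>\<close> pairs the coefficients \<open>a j\<close> with
  the \<open>\<langle>g,\<phi> j\<rangle>\<close>. Cauchy-Schwarz with
  \<open>\<beta> = B (norm g)\<^sup>2\<close> and division by \<open>(norm g)\<^sup>2\<close> give
  the bound.\<close>

lemma norm_sum_act_le:
  assumes bound: "\<And>f. norm (\<Sum>j\<in>F. ip f (\<phi> j) * ip (\<phi> j) f) \<le> B * (norm f)\<^sup>2" and "0 < B"
  shows "(norm (\<Sum>j\<in>F. act (a j) (\<phi> j)))\<^sup>2 \<le> B * norm (\<Sum>j\<in>F. a j * star (a j))"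
proof -
  define g where "g = (\<Sum>j\<in>F. act (a j) (\<phi> j))"
  have "(norm g)\<^sup>2 \<le> B * norm (\<Sum>j\<in>F. a j * star (a j))"
  proof (cases "g = 0")
    case False
    let ?\<beta> = "B * (norm g)\<^sup>2"
    have "(norm (\<Sum>j\<in>F. a j * star (ip g (\<phi> j))))\<^sup>2
        \<le> ?\<beta> * norm (\<Sum>j\<in>F. a j * star (a j))"
      by (rule norm_sum_mult_star_le)
        (use bound[of g] \<open>0 < B\<close> False in \<open>simp_all add: ip_star\<close>)
    also have "(\<Sum>j\<in>F. a j * star (ip g (\<phi> j))) = ip g g"
    proof -
      have "ip g g = ip (\<Sum>j\<in>F. act (a j) (\<phi> j)) g" by (simp flip: g_def)
      then show ?thesis by (simp add: ip_star ip_sum_left ip_act_left)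
    qed
    finally have "(norm g)\<^sup>2 * (norm g)\<^sup>2
        \<le> (norm g)\<^sup>2 * (B * norm (\<Sum>j\<in>F. a j * star (a j)))"
      by (simp add: norm_ip_self power2_eq_square mult.assoc mult.left_commute)
    then show ?thesis by (rule mult_left_le_imp_le) (use False in simp)
  qed (use \<open>0 < B\<close> in simp)
  then show ?thesis by (simp add: g_def)
qed

end

section \<open>Convergence and boundedness of the multiplier\<close>

theorem proposition4p1:
  fixes act :: "'a::unital_cstar_algebra \<Rightarrow> 'h::{complex_vector,banach} \<Rightarrow> 'h"
    and ip :: "'h \<Rightarrow> 'h \<Rightarrow> 'a"
    and C :: "'h \<Rightarrow> 'h"
    and J :: "'j set"
    and m :: "'j \<Rightarrow> 'a"
    and \<Phi> \<Psi> :: "'j \<Rightarrow> 'h"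
  assumes "hilbert_module act ip"
    and "finitely_generated act \<or> countably_generated act"
    and "C \<in> GL act"
    and "countable J"
    and "bounded (m ` J)"
    and "\<And>j. j \<in> J \<Longrightarrow> m j \<in> center"
    and "controlled_bessel ip C J \<Phi>"
    and "controlled_bessel ip C J \<Psi>"
    and "adjointable ip C \<or> controlled_frame_operator_converges act ip C J \<Psi>"
  shows "(\<forall>f. multiplier_term act ip C m \<Phi> \<Psi> f summable_on J) \<and>
         bounded_module_operator act (multiplier act ip C J m \<Phi> \<Psi>)"
proof -
  interpret hilbert_module act ip by fact
  have C_lin: "bounded_linear C" and C_act: "\<And>a f. C (act a f) = act a (C f)"
    using assms(3) by (auto simp: GL_def bounded_module_operator_def)
  obtain L where L: "L > 0" "\<And>f. norm (C f) \<le> norm f * L"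
    using bounded_linear.pos_bounded[OF C_lin] by blast
  obtain B\<^sub>1 where B\<^sub>1: "0 < B\<^sub>1" "\<And>F f. finite F \<Longrightarrow> F \<subseteq> J \<Longrightarrow>
      norm (\<Sum>j\<in>F. ip f (\<Phi> j) * ip (\<Phi> j) f) \<le> B\<^sub>1 * (norm f)\<^sup>2"
    using controlled_bessel_bound[OF assms(3,7)] by blast
  obtain B\<^sub>2 where B\<^sub>2: "0 < B\<^sub>2" "\<And>F f. finite F \<Longrightarrow> F \<subseteq> J \<Longrightarrow>
      norm (\<Sum>j\<in>F. ip f (\<Psi> j) * ip (\<Psi> j) f) \<le> B\<^sub>2 * (norm f)\<^sup>2"
    using controlled_bessel_bound[OF assms(3,8)] by blast
  obtain K where K: "K > 0" "\<And>j. j \<in> J \<Longrightarrow> norm (m j) \<le> K"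
    using assms(5) by (auto simp: bounded_pos)
  define t where "t = multiplier_term act ip C m \<Phi> \<Psi>"
  \<comment> \<open>One factor for each estimate in \<open>t_le\<close>: the bound of
    \<open>C\<close>, synthesis with \<open>\<Phi>\<close>, and the coefficients
    \<open>m j\<close>.\<close>
  define R where "R = L\<^sup>2 * B\<^sub>1 * K\<^sup>2"
  have R: "R > 0" using L(1) B\<^sub>1(1) K(1) by (simp add: R_def)
  have t_le: "(norm (sum (t f) F))\<^sup>2 \<le> R * norm (\<Sum>j\<in>F. ip f (\<Psi> j) * ip (\<Psi> j) f)"
    if F: "finite F" "F \<subseteq> J" for f F
  proof -
    let ?g = "\<Sum>j\<in>F. act (m j * ip f (\<Psi> j)) (\<Phi> j)"
    have "sum (t f) F = C ?g"
      by (simp add: t_def multiplier_term_def linear_sum[OF bounded_linear.linear[OF C_lin]] C_act)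
    then have "(norm (sum (t f) F))\<^sup>2 \<le> (norm ?g * L)\<^sup>2"
      by (simp add: L(2) power_mono)
    also have "\<dots> = L\<^sup>2 * (norm ?g)\<^sup>2" by (simp add: power_mult_distrib)
    also have "\<dots> \<le> L\<^sup>2 *
        (B\<^sub>1 * norm (\<Sum>j\<in>F. (m j * ip f (\<Psi> j)) * star (m j * ip f (\<Psi> j))))"
      by (intro mult_left_mono norm_sum_act_le[OF B\<^sub>1(2)[OF F] B\<^sub>1(1)]) simp
    also have "\<dots> \<le> L\<^sup>2 * (B\<^sub>1 * (K\<^sup>2 * norm (\<Sum>j\<in>F. ip f (\<Psi> j) * star (ip f (\<Psi> j)))))"
      using F(2) B\<^sub>1(1)
      by (intro mult_left_mono norm_sum_center_mult_le assms(6) K(2)) auto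
    finally show ?thesis by (simp add: R_def ip_star mult.assoc)
  qed
  have summable: "t f summable_on J" for f
    unfolding summable_on_Cauchy
  proof (intro allI impI)
    fix e :: real assume "e > 0"
    then have "e\<^sup>2 / R > 0" using R by simp
    then obtain F0 where F0: "finite F0" "F0 \<subseteq> J" "\<And>F. finite F \<Longrightarrow> F \<subseteq> J - F0 \<Longrightarrow>
        norm (\<Sum>j\<in>F. ip f (\<Psi> j) * ip (\<Psi> j) f) < e\<^sup>2 / R"
      using controlled_bessel_square_summable[OF assms(3,8,9), of f, unfolded summable_on_Cauchy,
          rule_format, of "e\<^sup>2 / R"]
      by auto
    have "norm (sum (t f) F) < e" if F: "finite F" "F \<subseteq> J - F0" for F
    proof -
      have "(norm (sum (t f) F))\<^sup>2 \<le> R * norm (\<Sum>j\<in>F. ip f (\<Psi> j) * ip (\<Psi> j) f)"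
        using F by (intro t_le) auto
      also have "\<dots> < R * (e\<^sup>2 / R)"
        using F R by (intro mult_strict_left_mono F0)
      also have "\<dots> = e\<^sup>2" using R by simp
      finally show ?thesis by (rule power2_less_imp_less) (use \<open>e > 0\<close> in simp)
    qed
    with F0 show "\<exists>F0. finite F0 \<and> F0 \<subseteq> J \<and>
        (\<forall>F. finite F \<and> F \<subseteq> J - F0 \<longrightarrow> norm (sum (t f) F) < e)"
      by blast
  qed
  define M where "M f = infsum (t f) J" for f
  have t_add: "t (f + g) j = t f j + t g j" for f g j
    by (simp add: t_def multiplier_term_def ip_add_left distrib_left act_add_left)
  \<comment> \<open>Centrality of \<open>m j\<close> is what makes the multiplier
    \<open>A\<close>-linear.\<close>
  have t_act: "t (act a f) j = act a (t f j)" if "j \<in> J" for a f j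
  proof -
    have "m j * a = a * m j" using assms(6)[OF that] by (simp add: center_def)
    then have "m j * (a * ip f (\<Psi> j)) = a * (m j * ip f (\<Psi> j))"
      by (simp flip: mult.assoc)
    then show ?thesis by (simp add: t_def multiplier_term_def ip_act_left act_act)
  qed
  have M_act: "M (act a f) = act a (M f)" for a f
  proof -
    have "M (act a f) = infsum (\<lambda>j. act a (t f j)) J"
      unfolding M_def by (rule infsum_cong) (rule t_act)
    also have "\<dots> = act a (M f)"
      unfolding M_def
      by (rule infsumI) (rule has_sum_bounded_linear[OF bounded_linear_act_right
            has_sum_infsum[OF summable]])
    finally show ?thesis .
  qed
  have "bounded_linear M"
  proof (rule bounded_linear_intro)
    show "M (f + g) = M f + M g" for f g
      unfolding M_def t_add by (rule infsum_add[OF summable summable])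
    \<comment> \<open>Real scalars act as multiples of the unit of \<open>A\<close>, so this is an
      instance of \<open>M_act\<close>.\<close>
    show "M (r *\<^sub>R f) = r *\<^sub>R M f" for r f
      using M_act[of "complex_of_real r *\<^sub>C 1" f]
      unfolding act_scaleC_one unfolding scaleC_of_real .
    \<comment> \<open>The constant combines \<open>t_le\<close> with the bound
      \<open>B\<^sub>2\<close> for \<open>\<Psi>\<close>.\<close>
    show "norm (M f) \<le> norm f * sqrt (R * B\<^sub>2)" for f
      unfolding M_def
    proof (rule norm_infsum_le_of_sums[OF summable])
      fix F assume F: "finite F" "F \<subseteq> J"
      have "(norm (sum (t f) F))\<^sup>2 \<le> R * (B\<^sub>2 * (norm f)\<^sup>2)"
        using R by (intro order_trans[OF t_le[OF F]] mult_left_mono B\<^sub>2(2) F) simp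
      also have "\<dots> = (norm f * sqrt (R * B\<^sub>2))\<^sup>2"
        using R B\<^sub>2(1) by (simp add: power_mult_distrib)
      finally show "norm (sum (t f) F) \<le> norm f * sqrt (R * B\<^sub>2)"
        by (rule power2_le_imp_le) (use R B\<^sub>2(1) in simp)
    qed
  qed
  moreover have "M = multiplier act ip C J m \<Phi> \<Psi>"
    by (simp add: fun_eq_iff M_def multiplier_def t_def)
  ultimately show ?thesis
    using summable M_act by (auto simp: bounded_module_operator_def t_def)
qed

end
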